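(* For every integer $n\ge0$, $$2^n\mu_n(a,b,c,d;q) = \sum_{k=0}^{n} \left(\binom{n}{\frac{n-k}2}-\binom{n}{\frac{n-k}2-1}\right) \sum_{\alpha+\beta+\gamma+\delta +2t=k} a^\alpha b^\beta c^\gamma d^\delta\, \frac{(ac)_{\beta}(bd)_{\gamma}}{(abcd)_{\beta+\gamma}}\,(-1)^{t} q^{\binom{t+1}2} \begin{bmatrix} \alpha+\beta+\gamma+t\\ \alpha\end{bmatrix}_q \begin{bmatrix} \beta+\gamma+\delta+t\\ \beta,\gamma,\delta+t\end{bmatrix}_q \begin{bmatrix} \delta+\alpha+t\\ \delta\end{bmatrix}_q,$$ where the second sum is over all integers $\alpha,\beta,\gamma,\delta\ge0$ and $-k\le t\le k/2$ with $\alpha+\beta+\gamma+\delta+2t=k$.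
   Context: Let $a,b,c,d,q$ be indeterminates (generic parameters). The monic Askey-Wilson polynomials $P_n(x)=P_n(x;a,b,c,d;q)$ are defined by $P_{-1}=0$, $P_0=1$, $P_{n+1}=(x-b_n)P_n-\lambda_nP_{n-1}$, with $b_n=\frac12(a+a^{-1}-(A_n+C_n))$, $\lambda_n=\frac14A_{n-1}C_n$, where $$A_n=\frac{(1-abq^n)(1-acq^n)(1-adq^n)(1-abcdq^{n-1})}{a(1-abcdq^{2n-1})(1-abcdq^{2n})},\quad C_n=\frac{a(1-q^n)(1-bcq^{n-1})(1-bdq^{n-1})(1-cdq^{n-1})}{(1-abcdq^{2n-2})(1-abcdq^{2n-1})}$$ (for $n=0$ the common factor $1-abcdq^{-1}$ in $A_0$ is cancelled, and $C_0=0$). The moment $\mu_n(a,b,c,d;q)=L(x^n)$, where $L$ is the unique linear functional on polynomials in $x$ with $L(1)=1$ and $L(P_n)=0$ for all $n\ge1$ (so that $L(P_mP_n)=0$ for $m\neq n$). It is a rational function of $a,b,c,d,q$, symmetric in $a,b,c,d$. Notation: $(x)_m=(x;q)_m=\prod_{i=0}^{m-1}(1-xq^i)$; $\begin{bmatrix} n\\k\end{bmatrix}_q=\frac{(q)_n}{(q)_k(q)_{n-k}}$ if $0\le k\le n$ and $0$ otherwise; $\begin{bmatrix} r+s+u\\ r,s,u\end{bmatrix}_q=\frac{(q)_{r+s+u}}{(q)_r(q)_s(q)_u}$ if $r,s,u\ge0$ and $0$ if any of $r,s,u$ is negative. $\binom nr=0$ unless $r$ is an integer with $0\le r\le n$ (so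 only $k\equiv n\bmod 2$ contribute). In the exponent of $q$, $\binom{t+1}{2}=t(t+1)/2$ for every integer $t$. *)

theory Defs
  imports "HOL-Computational_Algebra.Polynomial"
begin

text \<open>
  The parameters \<open>a, b, c, d, q\<close> are elements of an arbitrary field.  The only genericity used
  is that the denominators occurring in the formulas do not vanish (field division is total, with
  \<open>x / 0 = 0\<close>), so that indeterminates over a base field are one admissible choice.
\<close>

definition qpoch :: "'a::field \<Rightarrow> 'a \<Rightarrow> nat \<Rightarrow> 'a" where
  "qpoch x q m = (\<Prod>i<m. 1 - x * q ^ i)"

definition qbinom :: "'a::field \<Rightarrow> int \<Rightarrow> int \<Rightarrow> 'a" where
  "qbinom q n k =
    (if 0 \<le> k \<and> k \<le> n
     then qpoch q q (nat n) / (qpoch q q (nat k) * qpoch q q (nat (n - k))) else 0)"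

text \<open>\<open>qtrinom q r s u\<close> has upper entry \<open>r + s + u\<close> and lower entries \<open>r, s, u\<close>.\<close>

definition qtrinom :: "'a::field \<Rightarrow> int \<Rightarrow> int \<Rightarrow> int \<Rightarrow> 'a" where
  "qtrinom q r s u =
    (if 0 \<le> r \<and> 0 \<le> s \<and> 0 \<le> u
     then qpoch q q (nat (r + s + u)) / (qpoch q q (nat r) * qpoch q q (nat s) * qpoch q q (nat u))
     else 0)"

text \<open>The binomial coefficient \<open>n choose r\<close>, set to \<open>0\<close> unless \<open>r\<close> is an integer in \<open>[0, n]\<close>.\<close>

definition rat_choose :: "nat \<Rightarrow> rat \<Rightarrow> nat" where
  "rat_choose n r = (if r \<in> \<int> \<and> 0 \<le> r then n choose nat \<lfloor>r\<rfloor> else 0)"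

text \<open>
  In \<open>aw_A\<close> at \<open>n = 0\<close> the factor \<open>1 - abcd / q\<close> common to numerator and denominator is cancelled.
\<close>

definition aw_A :: "'a::field \<Rightarrow> 'a \<Rightarrow> 'a \<Rightarrow> 'a \<Rightarrow> 'a \<Rightarrow> nat \<Rightarrow> 'a" where
  "aw_A a b c d q n =
    (if n = 0
     then (1 - a * b) * (1 - a * c) * (1 - a * d) / (a * (1 - a * b * c * d))
     else (1 - a * b * q ^ n) * (1 - a * c * q ^ n) * (1 - a * d * q ^ n)
            * (1 - a * b * c * d * q ^ (n - 1))
          / (a * (1 - a * b * c * d * q ^ (2 * n - 1)) * (1 - a * b * c * d * q ^ (2 * n))))"

definition aw_C :: "'a::field \<Rightarrow> 'a \<Rightarrow> 'a \<Rightarrow> 'a \<Rightarrow> 'a \<Rightarrow> nat \<Rightarrow> 'a" where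
  "aw_C a b c d q n =
    (if n = 0 then 0
     else a * (1 - q ^ n) * (1 - b * c * q ^ (n - 1)) * (1 - b * d * q ^ (n - 1))
            * (1 - c * d * q ^ (n - 1))
          / ((1 - a * b * c * d * q ^ (2 * n - 2)) * (1 - a * b * c * d * q ^ (2 * n - 1))))"

definition aw_b :: "'a::field \<Rightarrow> 'a \<Rightarrow> 'a \<Rightarrow> 'a \<Rightarrow> 'a \<Rightarrow> nat \<Rightarrow> 'a" where
  "aw_b a b c d q n = (a + inverse a - (aw_A a b c d q n + aw_C a b c d q n)) / 2"

text \<open>Only used for \<open>n \<ge> 1\<close>.\<close>

definition aw_lambda :: "'a::field \<Rightarrow> 'a \<Rightarrow> 'a \<Rightarrow> 'a \<Rightarrow> 'a \<Rightarrow> nat \<Rightarrow> 'a" where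
  "aw_lambda a b c d q n = aw_A a b c d q (n - 1) * aw_C a b c d q n / 4"

fun aw_poly :: "'a::field \<Rightarrow> 'a \<Rightarrow> 'a \<Rightarrow> 'a \<Rightarrow> 'a \<Rightarrow> nat \<Rightarrow> 'a poly" where
  "aw_poly a b c d q 0 = 1"
| "aw_poly a b c d q (Suc 0) = [:- aw_b a b c d q 0, 1:]"
| "aw_poly a b c d q (Suc (Suc n)) =
     [:- aw_b a b c d q (Suc n), 1:] * aw_poly a b c d q (Suc n)
     - smult (aw_lambda a b c d q (Suc n)) (aw_poly a b c d q n)"

definition is_aw_functional ::
    "'a::field \<Rightarrow> 'a \<Rightarrow> 'a \<Rightarrow> 'a \<Rightarrow> 'a \<Rightarrow> ('a poly \<Rightarrow> 'a) \<Rightarrow> bool" where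
  "is_aw_functional a b c d q L \<longleftrightarrow>
     Vector_Spaces.linear smult (*) L \<and> L 1 = 1 \<and> (\<forall>n\<ge>1. L (aw_poly a b c d q n) = 0)"

definition aw_functional :: "'a::field \<Rightarrow> 'a \<Rightarrow> 'a \<Rightarrow> 'a \<Rightarrow> 'a \<Rightarrow> 'a poly \<Rightarrow> 'a" where
  "aw_functional a b c d q = (THE L. is_aw_functional a b c d q L)"

definition aw_moment :: "nat \<Rightarrow> 'a::field \<Rightarrow> 'a \<Rightarrow> 'a \<Rightarrow> 'a \<Rightarrow> 'a \<Rightarrow> 'a" where
  "aw_moment n a b c d q = aw_functional a b c d q (monom 1 n)"

definition aw_index :: "nat \<Rightarrow> (nat \<times> nat \<times> nat \<times> nat \<times> int) set" where
  "aw_index k = {(\<alpha>, \<beta>, \<gamma>, \<delta>, t).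
     - int k \<le> t \<and> 2 * t \<le> int k \<and> int \<alpha> + int \<beta> + int \<gamma> + int \<delta> + 2 * t = int k}"

lemma finite_aw_index: "finite (aw_index k)"
proof (rule finite_subset)
  show "aw_index k \<subseteq> {..3 * k} \<times> {..3 * k} \<times> {..3 * k} \<times> {..3 * k} \<times> {- int k..int k}"
    by (auto simp: aw_index_def)
qed simp

text \<open>The functional exists and is unique, so the definite description above is meaningful.\<close>

lemma aw_poly_monic: "degree (aw_poly a b c d q n) = n \<and> coeff (aw_poly a b c d q n) n = 1"
proof (induction a b c d q n rule: aw_poly.induct)
  case (3 a b c d q n)
  let ?p = "aw_poly a b c d q (Suc n)"
  let ?r = "smult (aw_lambda a b c d q (Suc n)) (aw_poly a b c d q n)"
  let ?l = "[:- aw_b a b c d q (Suc n), 1:]"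
  have p: "?p \<noteq> 0" using 3 by auto
  have d: "degree (?l * ?p) = Suc (Suc n)"
    using 3 p by (subst degree_mult_eq) auto
  have r: "degree ?r < Suc (Suc n)"
    using 3 by (auto intro: le_less_trans[OF degree_smult_le])
  have e: "aw_poly a b c d q (Suc (Suc n)) = ?l * ?p + - ?r" by simp
  have "degree (aw_poly a b c d q (Suc (Suc n))) = Suc (Suc n)"
    unfolding e using d r by (subst degree_add_eq_left) auto
  moreover have "coeff (?l * ?p) (Suc (Suc n)) = 1"
    using lead_coeff_mult[of ?l ?p] d 3 by simp
  ultimately show ?case
    using coeff_eq_0[OF r] unfolding e coeff_add coeff_minus by simp
qed auto

lemma ex1_aw_functional: "\<exists>!L. is_aw_functional a b c d q L"
proof -
  let ?P = "aw_poly a b c d q"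
  let ?rest = "\<lambda>n. (\<Sum>i<n. monom (coeff (?P n) i) i)"
  have P: "?P n = monom 1 n + ?rest n" for n
    using aw_poly_monic[of a b c d q n] poly_as_sum_of_monoms[of "?P n"]
    by (simp add: lessThan_Suc_atMost[symmetric] add.commute)
  have lin: "Vector_Spaces.linear smult (*) L \<longleftrightarrow>
      (\<forall>x y. L (x + y) = L x + L y) \<and> (\<forall>e x. L (smult e x) = e * L x)" for L :: "'a poly \<Rightarrow> 'a"
    by (auto simp: Vector_Spaces.linear_iff vector_space_def smult_add_right smult_add_left
        algebra_simps)
  have monom_sum: "L p = (\<Sum>i\<le>degree p. coeff p i * L (monom 1 i))"
    and rest: "L (?rest n) = (\<Sum>i<n. coeff (?P n) i * L (monom 1 i))"
    if "Vector_Spaces.linear smult (*) L" for L :: "'a poly \<Rightarrow> 'a" and p n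
  proof -
    interpret Vector_Spaces.linear smult "(*)" L by fact
    have m: "L (monom x i) = x * L (monom 1 i)" for x i
      using scale[of x "monom 1 i"] by (simp add: smult_monom)
    show "L (?rest n) = (\<Sum>i<n. coeff (?P n) i * L (monom 1 i))"
      unfolding sum by (rule sum.cong[OF refl m])
    have "L p = L (\<Sum>i\<le>degree p. monom (coeff p i) i)"
      by (simp add: poly_as_sum_of_monoms)
    also have "\<dots> = (\<Sum>i\<le>degree p. coeff p i * L (monom 1 i))"
      unfolding sum by (rule sum.cong[OF refl m])
    finally show "L p = (\<Sum>i\<le>degree p. coeff p i * L (monom 1 i))" .
  qed
  have "\<exists>mu. \<forall>n. mu n = (if n = 0 then 1 else - (\<Sum>i<n. coeff (?P n) i * mu i))"
    by (rule dependent_wellorder_choice) (auto intro!: sum.cong)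
  then obtain mu where
    mu_rec: "\<forall>n. mu n = (if n = 0 then 1 else - (\<Sum>i<n. coeff (?P n) i * mu i))" by blast
  have mu0: "mu 0 = 1"
    using mu_rec[rule_format, of 0] by simp
  have mu: "mu n = - (\<Sum>i<n. coeff (?P n) i * mu i)" if "n \<noteq> 0" for n
    using mu_rec[rule_format, of n] that by simp
  define M where "M p = (\<Sum>i\<le>degree p. coeff p i * mu i)" for p :: "'a poly"
  have Mge: "M p = (\<Sum>i\<le>N. coeff p i * mu i)" if "degree p \<le> N" for p N
    unfolding M_def using that by (intro sum.mono_neutral_left) (auto simp: coeff_eq_0)
  have Mlin: "Vector_Spaces.linear smult (*) M"
    unfolding lin
  proof (intro conjI allI)
    fix x y :: "'a poly"
    have "degree (x + y) \<le> max (degree x) (degree y)" by (rule degree_add_le_max)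
    then show "M (x + y) = M x + M y"
      by (simp add: Mge[of _ "max (degree x) (degree y)"] sum.distrib algebra_simps)
  next
    fix e :: 'a and x :: "'a poly"
    show "M (smult e x) = e * M x"
      using degree_smult_le[of e x]
      by (simp add: Mge[of _ "degree x"] sum_distrib_left mult.assoc)
  qed
  have "M (?P n) = 0" if "n \<ge> 1" for n
    using aw_poly_monic[of a b c d q n] mu[of n] that
    by (simp add: M_def lessThan_Suc_atMost[symmetric])
  then have "is_aw_functional a b c d q M"
    using Mlin mu0 by (simp add: is_aw_functional_def M_def)
  moreover have "L = L'" if "is_aw_functional a b c d q L" "is_aw_functional a b c d q L'" for L L'
  proof -
    note D = that[unfolded is_aw_functional_def]
    have eq: "L (monom 1 n) = L' (monom 1 n)" for n
    proof (induction n rule: less_induct)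
      case (less n)
      show ?case
      proof (cases "n = 0")
        case True
        then show ?thesis using D by (simp add: monom_eq_1)
      next
        case False
        have eq_rest: "L (?rest n) = L' (?rest n)"
          using less D by (simp add: rest)
        have step: "K (monom 1 n) = - K (?rest n)" if K: "is_aw_functional a b c d q K" for K
        proof -
          have "K (monom 1 n) + K (?rest n) = K (monom 1 n + ?rest n)"
            using K unfolding is_aw_functional_def lin by metis
          also have "\<dots> = K (?P n)"
            by (rule arg_cong[OF P[symmetric]])
          also have "\<dots> = 0"
            using K False by (simp add: is_aw_functional_def)
          finally show ?thesis by (simp only: add_eq_0_iff2)
        qed
        show ?thesis
          unfolding step[OF that(1)] step[OF that(2)] eq_rest ..
      qed
    qed
    show ?thesis
    proof
      fix p
      have "L p = (\<Sum>i\<le>degree p. coeff p i * L (monom 1 i))"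
        using D by (intro monom_sum) simp
      also have "\<dots> = (\<Sum>i\<le>degree p. coeff p i * L' (monom 1 i))"
        by (simp only: eq)
      also have "\<dots> = L' p"
        using D by (intro monom_sum[symmetric]) simp
      finally show "L p = L' p" .
    qed
  qed
  ultimately show ?thesis by blast
qed

end

theory Submission
  imports Defs
begin

text \<open>
  Let \<open>U_k\<close> be the Chebyshev polynomials of the second kind.  Since
  \<open>2 x U_k = U_(k+1) + U_(k-1)\<close>, the expansion of \<open>(2 x)^n\<close> in the \<open>U_k\<close> has the ballot numbers as
  coefficients, so the inner sum \<open>S_k(a)\<close> has to be \<open>L U_k\<close>.  Write \<open>E = a b c d\<close>.  The key is the
  contiguity relation
  \<open>(1 + a^2) S_k(a) - a (S_(k+1)(a) + S_(k-1)(a)) = (1 - ab)(1 - ac)(1 - ad) / (1 - E) S_k(a q)\<close>,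
  which reflects that multiplying the Askey-Wilson weight by \<open>1 + a^2 - 2 a x\<close> replaces \<open>a\<close> by \<open>a q\<close>.
  For three parameters \<open>(a, x, d)\<close> it is an identity between the coefficients of
  \<open>a^\<alpha> x^m d^\<delta>\<close>; the fourth parameter enters by replacing \<open>x^m\<close> with a sequence \<open>X_m\<close> for
  which \<open>X_m(a) - a X_(m+1)(a) = (1 - ab)(1 - ac) / (1 - E) X_m(a q)\<close>.
  If \<open>L_m\<close> is the functional with \<open>L_m U_k = S_k(a q^m)\<close>, contiguity expresses \<open>L_m (x p)\<close> through
  \<open>L_m p\<close> and \<open>L_(m+1) p\<close>.  With the three-term recurrence this yields a product formula for
  \<open>L_m P_n\<close> that contains the factor \<open>(q^m - 1) \<dots> (q^m - q^(n-1))\<close>, hence \<open>L_0 P_n = 0\<close> for \<open>n \<ge> 1\<close>.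
\<close>

section \<open>Coefficients of the three-parameter moments\<close>

lemma aw3_coeff_identity: fixes A M D T q :: "'a::field"
  shows "(1-A)*((1-A*M*T)*(1-A*D*T)*(1-M*T*q)*(1-D*T*q))
  + (-(T))*((1-M*D*T*q)*(1-A)*(q-A)*(1-A*T))
  + q*T*((1-A*M*T)*(1-A*D*T)*(1-M*D*T*q)*(1-A))
  - (1-A)*(1-A*T)*(1-M*T*q)*(1-D*T*q)
  = A*T*((1-A*D*T)*(1-A)*(1-M*T*q)*(1-M))
   + A*T*((1-A*M*T)*(1-A)*(1-D*T*q)*(1-D))
   + A*T^2*((1-A)*(q-A)*(1-M)*(1-D))"
  by algebra

definition qfact :: "'a::field \<Rightarrow> int \<Rightarrow> 'a" where
  "qfact q n = qpoch q q (nat n)"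

definition qinvfact :: "'a::field \<Rightarrow> int \<Rightarrow> 'a" where
  "qinvfact q n = (if n < 0 then 0 else inverse (qpoch q q (nat n)))"

definition signed_qpow :: "'a::field \<Rightarrow> int \<Rightarrow> 'a" where
  "signed_qpow q t = (-1) powi t * q powi (t * (t + 1) div 2)"

text \<open>
  The vanishing of \<open>qinvfact\<close> at negative arguments encodes all summation bounds, including those
  implicit in the \<open>q\<close>-binomials: if no \<open>qinvfact\<close> vanishes then the arguments of \<open>qfact\<close>
  are nonnegative, so its junk values are irrelevant.
\<close>

definition aw3_coeff :: "'a::field \<Rightarrow> int \<Rightarrow> int \<Rightarrow> int \<Rightarrow> int \<Rightarrow> 'a" where
  "aw3_coeff q x y z t = signed_qpow q t * qfact q (x+y+t) * qfact q (y+z+t) * qfact q (z+x+t)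
     * qinvfact q x * qinvfact q y * qinvfact q z * qinvfact q (x+t) * qinvfact q (y+t) * qinvfact q (z+t)"

lemma qpoch_Suc: "qpoch x q (Suc m) = qpoch x q m * (1 - x * q ^ m)"
  by (simp add: qpoch_def)

lemma qpoch_Suc_left: "qpoch x q (Suc m) = (1 - x) * qpoch (x * q) q m"
  by (simp add: qpoch_def prod.lessThan_Suc_shift mult.assoc del: prod.lessThan_Suc)

lemma qfact_rec: assumes "n > 0" shows "qfact q n = (1 - q powi n) * qfact q (n-1)"
proof -
  obtain m where m: "n = int (Suc m)" using assms gr0_implies_Suc pos_int_cases by metis
  have "int (Suc m) - 1 = int m" by simp
  then show ?thesis
    unfolding m qfact_def power_int_of_nat by (simp only: nat_int qpoch_Suc) simp
qed

lemma aw3_coeff_zero: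
  assumes "x < 0 \<or> y < 0 \<or> z < 0 \<or> x + t < 0 \<or> y + t < 0 \<or> z + t < 0"
  shows "aw3_coeff q x y z t = 0"
  using assms by (auto simp: aw3_coeff_def qinvfact_def)

context
  fixes q :: "'a::field"
  assumes q0: "q \<noteq> 0" and q1: "\<And>m::nat. m \<ge> 1 \<Longrightarrow> q ^ m \<noteq> 1"
begin

lemma qpoch_qq_nz: "qpoch q q m \<noteq> 0"
  using q1 by (auto simp: qpoch_def simp flip: power_Suc)

lemma qinvfact_rec: "qinvfact q (n - 1) = (1 - q powi n) * qinvfact q n"
proof (cases "n > 0")
  case True
  have "qfact q n \<noteq> 0" "qfact q (n-1) \<noteq> 0" unfolding qfact_def by (simp_all add: qpoch_qq_nz)
  then show ?thesis using qfact_rec[OF True, of q] True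
    by (auto simp: qinvfact_def qfact_def field_simps)
qed (auto simp: qinvfact_def)

lemma signed_qpow_rec: "signed_qpow q (t + 1) = - (q powi (t + 1)) * signed_qpow q t"
proof -
  have "(t + 1) * (t + 1 + 1) div 2 = t * (t + 1) div 2 + (t + 1)"
    by (simp add: algebra_simps)
  then show ?thesis using q0 by (simp add: signed_qpow_def power_int_add)
qed

lemma aw3_coeff_rec_generic:
  assumes "x + y + t > 0" "x + z + t > 0" "y + z + t \<ge> 0"
  shows "aw3_coeff q x y z t + aw3_coeff q (x-2) y z (t+1) - aw3_coeff q (x-1) y z (t+1)
      - aw3_coeff q (x-1) y z t
     = q powi x * aw3_coeff q x y z t - q powi (x-1) * aw3_coeff q (x-1) (y-1) z (t+1)
       - q powi (x-1) * aw3_coeff q (x-1) y (z-1) (t+1)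
           + q powi (x-2) * aw3_coeff q (x-2) (y-1) (z-1) (t+2)"
proof -
  define A where "A = q powi x"
  define M where "M = q powi y"
  define D where "D = q powi z"
  define T where "T = q powi t"
  define B where "B = signed_qpow q t * qfact q (x+y+t-1) * qfact q (x+z+t-1) * qfact q (y+z+t)
     * qinvfact q x * qinvfact q y * qinvfact q z * qinvfact q (x+t) * qinvfact q (y+t+1)
         * qinvfact q (z+t+1)"
  have pw: "q powi (x - 1) = A / q" "q powi (x - 2) = A / q^2"
     "q powi (x+y+t) = A*M*T" "q powi (x+z+t) = A*D*T" "q powi (y+z+t+1) = M*D*T*q"
     "q powi (x+t) = A*T" "q powi (y+t+1) = M*T*q" "q powi (z+t+1) = D*T*q"
     "q powi (t+1) = T*q" "q powi (t+2) = T*q*q"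
    using q0 by (simp_all add: A_def M_def D_def T_def power_int_add power_int_diff power2_eq_square)
  have f: "qfact q (x+y+t) = (1 - A*M*T) * qfact q (x+y+t-1)"
     "qfact q (x+z+t) = (1 - A*D*T) * qfact q (x+z+t-1)"
     "qfact q (y+z+t+1) = (1 - M*D*T*q) * qfact q (y+z+t)"
    using qfact_rec[of "x+y+t" q] qfact_rec[of "x+z+t" q] qfact_rec[of "y+z+t+1" q] assms
        by (simp_all add: pw)
  have r: "qinvfact q (x-1) = (1-A) * qinvfact q x" "qinvfact q (x-2) = (1-A/q) * ((1-A) * qinvfact q x)"
    "qinvfact q (y-1) = (1-M) * qinvfact q y" "qinvfact q (z-1) = (1-D) * qinvfact q z"
    "qinvfact q (x+t-1) = (1-A*T) * qinvfact q (x+t)" "qinvfact q (y+t) = (1-M*T*q) * qinvfact q (y+t+1)"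
    "qinvfact q (z+t) = (1-D*T*q) * qinvfact q (z+t+1)"
    using qinvfact_rec[of x] qinvfact_rec[of "x-1"] qinvfact_rec[of y] qinvfact_rec[of z]
        qinvfact_rec[of "x+t"]
      qinvfact_rec[of "y+t+1"] qinvfact_rec[of "z+t+1"]
    by (simp_all add: pw A_def[symmetric] M_def[symmetric] D_def[symmetric])
  have t: "signed_qpow q (t+1) = - (T*q) * signed_qpow q t"
      "signed_qpow q (t+2) = T*q*q*(T*q) * signed_qpow q t"
    using signed_qpow_rec[of t] signed_qpow_rec[of "t+1"] by (simp_all add: pw add.assoc[of t 1 1])
  have W1: "aw3_coeff q x y z t = B * ((1-A*M*T)*(1-A*D*T)*(1-M*T*q)*(1-D*T*q))"
    unfolding aw3_coeff_def B_def by (simp add: f r add.commute[of z x])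
  have W2: "aw3_coeff q (x-2) y z (t+1) = - (T*q) * B * ((1-M*D*T*q)*(1-A)*(1-A/q)*(1-A*T))"
  proof -
    have "x-2+y+(t+1) = x+y+t-1" "y+z+(t+1) = y+z+t+1" "z+(x-2)+(t+1) = x+z+t-1"
      "x-2+(t+1) = x+t-1" "y+(t+1) = y+t+1" "z+(t+1) = z+t+1" by simp_all
    then show ?thesis unfolding aw3_coeff_def B_def by (simp only: f r t) (simp add: mult_ac)
  qed
  have W3: "aw3_coeff q (x-1) y z (t+1) = - (T*q) * B * ((1-A*M*T)*(1-A*D*T)*(1-M*D*T*q)*(1-A))"
  proof -
    have "x-1+y+(t+1) = x+y+t" "y+z+(t+1) = y+z+t+1" "z+(x-1)+(t+1) = x+z+t"
      "x-1+(t+1) = x+t" "y+(t+1) = y+t+1" "z+(t+1) = z+t+1" by simp_all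
    then show ?thesis unfolding aw3_coeff_def B_def by (simp only: f r t) (simp add: mult_ac)
  qed
  have W4: "aw3_coeff q (x-1) y z t = B * ((1-A)*(1-A*T)*(1-M*T*q)*(1-D*T*q))"
  proof -
    have "x-1+y+t = x+y+t-1" "z+(x-1)+t = x+z+t-1" "x-1+t = x+t-1" by simp_all
    then show ?thesis unfolding aw3_coeff_def B_def by (simp only: f r t) (simp add: mult_ac)
  qed
  have W5: "aw3_coeff q (x-1) (y-1) z (t+1) = - (T*q) * B * ((1-A*D*T)*(1-A)*(1-M*T*q)*(1-M))"
  proof -
    have "x-1+(y-1)+(t+1) = x+y+t-1" "y-1+z+(t+1) = y+z+t" "z+(x-1)+(t+1) = x+z+t"
      "x-1+(t+1) = x+t" "y-1+(t+1) = y+t" "z+(t+1) = z+t+1" by simp_all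
    then show ?thesis unfolding aw3_coeff_def B_def by (simp only: f r t) (simp add: mult_ac)
  qed
  have W6: "aw3_coeff q (x-1) y (z-1) (t+1) = - (T*q) * B * ((1-A*M*T)*(1-A)*(1-D*T*q)*(1-D))"
  proof -
    have "x-1+y+(t+1) = x+y+t" "y+(z-1)+(t+1) = y+z+t" "z-1+(x-1)+(t+1) = x+z+t-1"
      "x-1+(t+1) = x+t" "y+(t+1) = y+t+1" "z-1+(t+1) = z+t" by simp_all
    then show ?thesis unfolding aw3_coeff_def B_def by (simp only: f r t) (simp add: mult_ac)
  qed
  have W7: "aw3_coeff q (x-2) (y-1) (z-1) (t+2) = T*q*q*(T*q) * B * ((1-A)*(1-A/q)*(1-M)*(1-D))"
  proof -
    have "x-2+(y-1)+(t+2) = x+y+t-1" "y-1+(z-1)+(t+2) = y+z+t" "z-1+(x-2)+(t+2) = x+z+t-1"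
      "x-2+(t+2) = x+t" "y-1+(t+2) = y+t+1" "z-1+(t+2) = z+t+1" by simp_all
    then show ?thesis unfolding aw3_coeff_def B_def by (simp only: f r t) (simp add: mult_ac)
  qed
  have *: "(1-A/q) * q = q - A" using q0 by (simp add: field_simps)
  have "(aw3_coeff q x y z t + aw3_coeff q (x-2) y z (t+1) - aw3_coeff q (x-1) y z (t+1)
      - aw3_coeff q (x-1) y z t) - A * aw3_coeff q x y z t
    = B * ((1-A)*((1-A*M*T)*(1-A*D*T)*(1-M*T*q)*(1-D*T*q))
  + (-(T))*((1-M*D*T*q)*(1-A)*((1-A/q)*q)*(1-A*T))
  + q*T*((1-A*M*T)*(1-A*D*T)*(1-M*D*T*q)*(1-A))
  - (1-A)*(1-A*T)*(1-M*T*q)*(1-D*T*q))"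
    unfolding W1 W2 W3 W4 by algebra
  also have "\<dots> = B * (A*T*((1-A*D*T)*(1-A)*(1-M*T*q)*(1-M))
   + A*T*((1-A*M*T)*(1-A)*(1-D*T*q)*(1-D))
   + A*T^2*((1-A)*(q-A)*(1-M)*(1-D)))"
    unfolding * aw3_coeff_identity ..
  also have "\<dots> = - (A/q) * aw3_coeff q (x-1) (y-1) z (t+1)
       - (A/q) * aw3_coeff q (x-1) y (z-1) (t+1) + (A/q^2) * aw3_coeff q (x-2) (y-1) (z-1) (t+2)"
    unfolding W5 W6 W7 *[symmetric] using q0 by (simp add: field_simps power2_eq_square)
  finally show ?thesis unfolding pw A_def[symmetric] by algebra
qed

lemma aw3_coeff_axis: "aw3_coeff q 0 0 z 0 = 1" "aw3_coeff q 0 z 0 0 = 1" "aw3_coeff q z 0 0 0 = 1" if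
    "z \<ge> 0"
proof -
  have "qfact q 0 = 1" "qinvfact q 0 = 1" "signed_qpow q 0 = 1"
    by (simp_all add: qfact_def qinvfact_def signed_qpow_def qpoch_def)
  moreover have "qfact q z * qinvfact q z = 1"
    using that qpoch_qq_nz[of "nat z"] by (simp add: qfact_def qinvfact_def)
  ultimately show "aw3_coeff q 0 0 z 0 = 1" "aw3_coeff q 0 z 0 0 = 1" "aw3_coeff q z 0 0 0 = 1"
    by (simp_all add: aw3_coeff_def mult.assoc mult.left_commute)
qed

text \<open>The last assumption is needed: the identity fails at \<open>x = 1\<close>, \<open>y = z = 0\<close>, \<open>t = -1\<close>.\<close>

lemma aw3_coeff_rec:
  assumes "x \<ge> 0" "y \<ge> 0" "z \<ge> 0" "x + y + z + 2 * t \<ge> 0"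
  shows "aw3_coeff q x y z t + aw3_coeff q (x-2) y z (t+1) - aw3_coeff q (x-1) y z (t+1)
      - aw3_coeff q (x-1) y z t
     = q powi x * aw3_coeff q x y z t - q powi (x-1) * aw3_coeff q (x-1) (y-1) z (t+1)
       - q powi (x-1) * aw3_coeff q (x-1) y (z-1) (t+1)
           + q powi (x-2) * aw3_coeff q (x-2) (y-1) (z-1) (t+2)"
proof -
  consider "x + t < 0 \<or> y + t < -1 \<or> z + t < -1" | "x = 0"
    | "x = 1" "y = 0" "t = -1" "z > 0" | "x = 1" "z = 0" "t = -1" "y > 0"
    | "x > 1" "t = -1" "y = 0" "z = 0"
    | "x + y + t > 0" "x + z + t > 0" "y + z + t \<ge> 0"
    using assms by linarith
  then show ?thesis
  proof cases
    case 1 then show ?thesis by (auto simp: aw3_coeff_zero)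
  next
    case 2 then show ?thesis by (auto simp: aw3_coeff_zero)
  next
    case 3 then show ?thesis by (auto simp: aw3_coeff_zero aw3_coeff_axis)
  next
    case 4 then show ?thesis by (auto simp: aw3_coeff_zero aw3_coeff_axis)
  next
    case 5 then show ?thesis by (auto simp: aw3_coeff_zero aw3_coeff_axis)
  next
    case 6 then show ?thesis by (rule aw3_coeff_rec_generic)
  qed
qed
end

section \<open>Chebyshev moments and their contiguity relation\<close>

definition gauss_binom :: "'a::field \<Rightarrow> int \<Rightarrow> int \<Rightarrow> 'a" where
  "gauss_binom q m i = qfact q m * qinvfact q i * qinvfact q (m - i)"

text \<open>
  Replacing \<open>x^m\<close> by this sequence turns the moments for \<open>(a, x, d, 0)\<close> into those for
  \<open>(a, b, c, d)\<close>.
\<close>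

definition pair_seq :: "'a::field \<Rightarrow> 'a \<Rightarrow> 'a \<Rightarrow> 'a \<Rightarrow> 'a \<Rightarrow> nat \<Rightarrow> 'a" where
  "pair_seq a b c d q m = (\<Sum>i\<le>m. gauss_binom q (int m) (int i)
      * (b ^ i * c ^ (m - i) * qpoch (a * c) q i * qpoch (b * d) q (m - i)))
      / qpoch (a * b * c * d) q m"

definition aw3_term :: "'a::field \<Rightarrow> int \<Rightarrow> int \<Rightarrow> int \<Rightarrow> int \<Rightarrow> 'a" where
  "aw3_term q k x y z = (if even (k - x - y - z) then aw3_coeff q x y z ((k - x - y - z) div 2) else 0)"

definition box_sum :: "nat \<Rightarrow> 'a::field \<Rightarrow> (nat \<Rightarrow> 'a) \<Rightarrow> 'a \<Rightarrow> (int \<Rightarrow> int \<Rightarrow> int \<Rightarrow> 'a) \<Rightarrow> 'a" where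
  "box_sum K a X d F = (\<Sum>x\<le>K. \<Sum>y\<le>K. \<Sum>z\<le>K. a ^ x * X y * d ^ z * F (int x) (int y) (int z))"

lemma aw3_term_eq: "k - x - y - z = 2 * t \<Longrightarrow> aw3_term q k x y z = aw3_coeff q x y z t"
  by (simp add: aw3_term_def)

lemma aw3_term_odd: "odd (k - x - y - z) \<Longrightarrow> aw3_term q k x y z = 0"
  by (simp add: aw3_term_def)

lemma aw3_term_zero:
  assumes "x < 0 \<or> y < 0 \<or> z < 0 \<or> x > k \<or> y > k \<or> z > k"
  shows "aw3_term q k x y z = 0"
proof (cases "even (k - x - y - z)")
  case True
  then obtain t where t: "k = x + y + z + 2 * t"
      by (metis add_diff_cancel_left' diff_diff_eq evenE diff_add_cancel add.commute)
  have "x < 0 \<or> y < 0 \<or> z < 0 \<or> x + t < 0 \<or> y + t < 0 \<or> z + t < 0"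
    using assms unfolding t by linarith
  then show ?thesis unfolding t by (simp add: aw3_term_def aw3_coeff_zero)
qed (simp add: aw3_term_def)

lemma box_sum_add: "box_sum K a X d (\<lambda>x y z. F x y z + G x y z) = box_sum K a X d F + box_sum K a X d G"
  by (simp add: box_sum_def sum.distrib distrib_left)

lemma box_sum_diff: "box_sum K a X d (\<lambda>x y z. F x y z - G x y z) = box_sum K a X d F - box_sum K a X d G"
  by (simp add: box_sum_def sum_subtractf right_diff_distrib)

lemma box_sum_diff_seq: "box_sum K a X d F - e * box_sum K a X' d F = box_sum K a (\<lambda>m. X m - e * X' m) d F"
  by (simp add: box_sum_def sum_subtractf sum_distrib_left algebra_simps)

lemma box_sum_scale_seq: "box_sum K a (\<lambda>m. e * X m) d F = e * box_sum K a X d F"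
  by (simp add: box_sum_def sum_distrib_left algebra_simps)

lemma box_sum_cong:
  assumes "\<And>x y z. x \<ge> 0 \<Longrightarrow> y \<ge> 0 \<Longrightarrow> z \<ge> 0 \<Longrightarrow> F x y z = G x y z"
  shows "box_sum K a X d F = box_sum K a X d G"
  by (simp add: box_sum_def assms)

lemma box_sum_mono:
  assumes "K \<le> K'" "\<And>x y z. x > int K \<or> y > int K \<or> z > int K \<Longrightarrow> F x y z = 0"
  shows "box_sum K' a X d F = box_sum K a X d F"
  unfolding box_sum_def
  by (intro sum.mono_neutral_cong_right) (use assms in \<open>auto intro!: sum.neutral sum.mono_neutral_right\<close>)

lemma sum_shift_int:
  fixes F :: "int \<Rightarrow> 'a::comm_ring_1"
  assumes "F (-1) = 0" "F (int K) = 0"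
  shows "(\<Sum>i\<le>K. h (Suc i) * F (int i)) = (\<Sum>i\<le>K. h i * F (int i - 1))"
proof -
  have "(\<Sum>i\<le>Suc K. h i * F (int i - 1)) = (\<Sum>i\<le>K. h (Suc i) * F (int i))"
    by (subst sum.atMost_Suc_shift) (simp add: assms)
  then show ?thesis by (simp add: assms)
qed

lemma box_sum_shift_x:
  assumes "\<And>y z. F (-1) y z = 0" "\<And>y z. F (int K) y z = 0"
  shows "a * box_sum K a X d F = box_sum K a X d (\<lambda>x. F (x - 1))"
proof -
  have "a * box_sum K a X d F = (\<Sum>x\<le>K. a ^ Suc x * (\<Sum>y\<le>K. \<Sum>z\<le>K. X y * d ^ z * F (int x) (int y) (int z)))"
    by (simp add: box_sum_def sum_distrib_left mult.assoc)
  also have "\<dots> = (\<Sum>x\<le>K. a ^ x * (\<Sum>y\<le>K. \<Sum>z\<le>K. X y * d ^ z * F (int x - 1) (int y) (int z)))"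
    by (rule sum_shift_int) (simp_all add: assms)
  finally show ?thesis by (simp add: box_sum_def sum_distrib_left mult.assoc)
qed

lemma box_sum_shift_y:
  assumes "\<And>x z. F x (-1) z = 0" "\<And>x z. F x (int K) z = 0"
  shows "box_sum K a (\<lambda>m. X (Suc m)) d F = box_sum K a X d (\<lambda>x y. F x (y - 1))"
proof -
  have "box_sum K a (\<lambda>m. X (Suc m)) d F =
      (\<Sum>x\<le>K. \<Sum>y\<le>K. X (Suc y) * (\<Sum>z\<le>K. a ^ x * d ^ z * F (int x) (int y) (int z)))"
    by (simp add: box_sum_def sum_distrib_left mult_ac)
  also have "\<dots> = (\<Sum>x\<le>K. \<Sum>y\<le>K. X y * (\<Sum>z\<le>K. a ^ x * d ^ z * F (int x) (int y - 1) (int z)))"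
    by (intro sum.cong refl sum_shift_int) (simp_all add: assms)
  finally show ?thesis by (simp add: box_sum_def sum_distrib_left mult_ac)
qed

lemma box_sum_shift_z:
  assumes "\<And>x y. F x y (-1) = 0" "\<And>x y. F x y (int K) = 0"
  shows "d * box_sum K a X d F = box_sum K a X d (\<lambda>x y z. F x y (z - 1))"
proof -
  have "d * box_sum K a X d F = (\<Sum>x\<le>K. \<Sum>y\<le>K. \<Sum>z\<le>K. (a ^ x * X y * d ^ Suc z) * F (int x) (int y) (int z))"
    by (simp add: box_sum_def sum_distrib_left mult_ac)
  also have "\<dots> = (\<Sum>x\<le>K. \<Sum>y\<le>K. \<Sum>z\<le>K. (a ^ x * X y * d ^ z) * F (int x) (int y) (int z - 1))"
    by (intro sum.cong refl sum_shift_int) (simp_all add: assms)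
  finally show ?thesis by (simp add: box_sum_def)
qed

lemma box_sum_dilate: "box_sum K (a * q) X d F = box_sum K a X d (\<lambda>x y z. q powi x * F x y z)"
  by (simp add: box_sum_def power_mult_distrib mult_ac)

context
  fixes q :: "'a::field"
  assumes q0: "q \<noteq> 0" and q1: "\<And>m::nat. m \<ge> 1 \<Longrightarrow> q ^ m \<noteq> 1"
begin

lemma aw3_term_rec:
  assumes "k \<ge> 0" "x \<ge> 0" "y \<ge> 0" "z \<ge> 0"
  shows "aw3_term q k x y z + aw3_term q k (x-2) y z - aw3_term q (k+1) (x-1) y z
      - aw3_term q (k-1) (x-1) y z
     = q powi x * aw3_term q k x y z - q powi (x-1) * aw3_term q k (x-1) (y-1) z
       - q powi (x-1) * aw3_term q k (x-1) y (z-1) + q powi (x-2) * aw3_term q k (x-2) (y-1) (z-1)"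
proof (cases "even (k - x - y - z)")
  case True
  then obtain t where t: "k - x - y - z = 2 * t" by (rule evenE)
  then have *: "aw3_term q k x y z = aw3_coeff q x y z t"
      "aw3_term q k (x-2) y z = aw3_coeff q (x-2) y z (t+1)"
      "aw3_term q (k+1) (x-1) y z = aw3_coeff q (x-1) y z (t+1)"
          "aw3_term q (k-1) (x-1) y z = aw3_coeff q (x-1) y z t"
      "aw3_term q k (x-1) (y-1) z = aw3_coeff q (x-1) (y-1) z (t+1)"
          "aw3_term q k (x-1) y (z-1) = aw3_coeff q (x-1) y (z-1) (t+1)"
      "aw3_term q k (x-2) (y-1) (z-1) = aw3_coeff q (x-2) (y-1) (z-1) (t+2)"
    by (auto intro!: aw3_term_eq)
  have "x + y + z + 2 * t \<ge> 0" using t assms by linarith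
  from aw3_coeff_rec[OF q0 q1 assms(2-4) this] show ?thesis
    unfolding * .
next
  case False
  then have o: "odd (k - (x-2) - y - z)" "odd (k + 1 - (x-1) - y - z)"
     "odd (k - 1 - (x-1) - y - z)" "odd (k - (x-1) - (y-1) - z)"
     "odd (k - (x-1) - y - (z-1))" "odd (k - (x-2) - (y-1) - (z-1))"
    by presburger+
  show ?thesis unfolding o[THEN aw3_term_odd] False[THEN aw3_term_odd] by simp
qed

lemma box_sum_rec:
  assumes "k \<ge> 0" and K: "int K > k + 2"
  shows "(1 + a\<^sup>2) * box_sum K a X d (aw3_term q k)
      - a * (box_sum K a X d (aw3_term q (k+1)) + box_sum K a X d (aw3_term q (k-1)))
    = (1 - a * d) * (box_sum K (a * q) X d (aw3_term q k)
        - a * box_sum K (a * q) (\<lambda>m. X (Suc m)) d (aw3_term q k))"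
proof -
  note z = aw3_term_zero[where q = q]
  have a2: "a\<^sup>2 * box_sum K a X d (aw3_term q k) = box_sum K a X d (\<lambda>x y z. aw3_term q k (x-2) y z)"
  proof -
    have "a * box_sum K a X d (aw3_term q k) = box_sum K a X d (\<lambda>x y z. aw3_term q k (x-1) y z)"
      by (rule box_sum_shift_x; use K in \<open>auto simp: z\<close>)
    moreover have "a * box_sum K a X d (\<lambda>x y z. aw3_term q k (x-1) y z)
        = box_sum K a X d (\<lambda>x y z. aw3_term q k (x-1-1) y z)"
      by (rule box_sum_shift_x; use K in \<open>auto simp: z\<close>)
    ultimately show ?thesis by (simp add: power2_eq_square mult.assoc)
  qed
  have s1: "a * box_sum K a X d (aw3_term q (k+1)) = box_sum K a X d (\<lambda>x y z. aw3_term q (k+1) (x-1) y z)"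
    "a * box_sum K a X d (aw3_term q (k-1)) = box_sum K a X d (\<lambda>x y z. aw3_term q (k-1) (x-1) y z)"
    by (rule box_sum_shift_x; use K in \<open>auto simp: z\<close>)+
  define G where "G x y z = q powi x * aw3_term q k x y z" for x y z
  have Gz: "G x y z = 0" if "x < 0 \<or> y < 0 \<or> z < 0 \<or> x > k \<or> y > k \<or> z > k" for x y z
    using z[OF that] by (simp add: G_def)
  have t1: "box_sum K (a * q) X d (aw3_term q k) = box_sum K a X d G"
    by (simp add: box_sum_dilate G_def[abs_def])
  have t2: "a * box_sum K (a * q) (\<lambda>m. X (Suc m)) d (aw3_term q k)
      = box_sum K a X d (\<lambda>x y z. G (x-1) (y-1) z)"
  proof -
    have "box_sum K (a * q) (\<lambda>m. X (Suc m)) d (aw3_term q k) = box_sum K a (\<lambda>m. X (Suc m)) d G"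
      by (simp add: box_sum_dilate G_def[abs_def])
    also have "\<dots> = box_sum K a X d (\<lambda>x y z. G x (y-1) z)"
      by (rule box_sum_shift_y) (use K in \<open>auto simp: Gz\<close>)
    also have "a * \<dots> = box_sum K a X d (\<lambda>x y z. G (x-1) (y-1) z)"
      by (rule box_sum_shift_x) (use K in \<open>auto simp: Gz\<close>)
    finally show ?thesis .
  qed
  have ad: "a * d * box_sum K a X d F = box_sum K a X d (\<lambda>x y z. F (x-1) y (z-1))"
    if "\<And>x y z. x < 0 \<or> y < 0 \<or> z < 0 \<or> x > k + 1 \<or> y > k + 1 \<or> z > k + 1 \<Longrightarrow> F x y z = 0" for F
  proof -
    have "d * box_sum K a X d F = box_sum K a X d (\<lambda>x y z. F x y (z-1))"
      by (rule box_sum_shift_z) (use K in \<open>auto simp: that\<close>)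
    moreover have "a * box_sum K a X d (\<lambda>x y z. F x y (z-1)) = box_sum K a X d (\<lambda>x y z. F (x-1) y (z-1))"
      by (rule box_sum_shift_x) (use K in \<open>auto simp: that\<close>)
    ultimately show ?thesis by (simp add: mult.assoc)
  qed
  have t3: "a * d * box_sum K a X d G = box_sum K a X d (\<lambda>x y z. G (x-1) y (z-1))"
    by (rule ad) (auto simp: Gz)
  have t4: "a * d * box_sum K a X d (\<lambda>x y z. G (x-1) (y-1) z)
      = box_sum K a X d (\<lambda>x y z. G (x-1-1) (y-1) (z-1))"
    by (rule ad) (auto simp: Gz)
  have "(1 + a\<^sup>2) * box_sum K a X d (aw3_term q k)
      - a * (box_sum K a X d (aw3_term q (k+1)) + box_sum K a X d (aw3_term q (k-1)))
    = box_sum K a X d (\<lambda>x y z. aw3_term q k x y z + aw3_term q k (x-2) y z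
        - aw3_term q (k+1) (x-1) y z - aw3_term q (k-1) (x-1) y z)"
    unfolding box_sum_diff box_sum_add distrib_left distrib_right a2 s1 by simp
  also have "\<dots> = box_sum K a X d (\<lambda>x y z. G x y z - G (x-1) (y-1) z - G (x-1) y (z-1)
      + G (x-1-1) (y-1) (z-1))"
    by (rule box_sum_cong) (use aw3_term_rec[OF assms(1)] in \<open>simp add: G_def\<close>)
  also have "\<dots> = box_sum K a X d G - box_sum K a X d (\<lambda>x y z. G (x-1) (y-1) z) - a * d * box_sum K a X d G
       + a * d * box_sum K a X d (\<lambda>x y z. G (x-1) (y-1) z)"
    unfolding box_sum_diff box_sum_add t3 t4 ..
  also have "\<dots> = (1 - a * d) * (box_sum K a X d G - box_sum K a X d (\<lambda>x y z. G (x-1) (y-1) z))"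
    by (simp add: algebra_simps)
  finally show ?thesis unfolding t1 t2 .
qed

lemma gauss_binom_pascal:
  assumes "m \<ge> 0"
  shows "gauss_binom q (m + 1) i = gauss_binom q m (i - 1) + q powi i * gauss_binom q m i"
proof -
  have "q powi (m + 1) = q powi i * q powi (m + 1 - i)"
    using q0 by (simp flip: power_int_add)
  moreover have "qinvfact q (m - i) = (1 - q powi (m + 1 - i)) * qinvfact q (m + 1 - i)"
    using qinvfact_rec[OF q0 q1, of "m + 1 - i"] by simp
  moreover have "m - (i - 1) = m + 1 - i" by simp
  ultimately show ?thesis
    using qfact_rec[of "m + 1" q] qinvfact_rec[OF q0 q1, of i] assms
    by (simp add: gauss_binom_def) (simp add: algebra_simps)
qed

lemma sum_gauss_binom_Suc:
  "(\<Sum>i\<le>Suc m. gauss_binom q (int (Suc m)) (int i) * g i (Suc m - i))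
    = (\<Sum>i\<le>m. gauss_binom q (int m) (int i) * (g (Suc i) (m - i) + q ^ i * g i (Suc (m - i))))"
proof -
  have "(\<Sum>i\<le>Suc m. gauss_binom q (int (Suc m)) (int i) * g i (Suc m - i))
    = (\<Sum>i\<le>Suc m. gauss_binom q (int m) (int i - 1) * g i (Suc m - i))
      + (\<Sum>i\<le>Suc m. q ^ i * gauss_binom q (int m) (int i) * g i (Suc m - i))"
    unfolding sum.distrib[symmetric]
    by (intro sum.cong refl) (use gauss_binom_pascal[of "int m"] in \<open>simp add: distrib_right add.commute\<close>)
  also have "(\<Sum>i\<le>Suc m. gauss_binom q (int m) (int i - 1) * g i (Suc m - i))
    = (\<Sum>i\<le>m. gauss_binom q (int m) (int i) * g (Suc i) (m - i))"
    by (subst sum.atMost_Suc_shift) (simp add: gauss_binom_def qinvfact_def)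
  also have "(\<Sum>i\<le>Suc m. q ^ i * gauss_binom q (int m) (int i) * g i (Suc m - i))
    = (\<Sum>i\<le>m. q ^ i * gauss_binom q (int m) (int i) * g i (Suc (m - i)))"
    by (simp add: gauss_binom_def[of q "int m" "1 + int m"] qinvfact_def Suc_diff_le)
  finally show ?thesis
    by (simp add: sum.distrib[symmetric] algebra_simps)
qed

lemma pair_seq_rec:
  assumes E: "\<And>m::nat. a * b * c * d * q ^ m \<noteq> 1"
  shows "pair_seq a b c d q m - a * pair_seq a b c d q (Suc m)
    = (1 - a * b) * (1 - a * c) / (1 - a * b * c * d) * pair_seq (a * q) b c d q m"
proof -
  let ?E = "a * b * c * d"
  define g where "g i j = b ^ i * c ^ j * qpoch (a * c) q i * qpoch (b * d) q j" for i j
  define g' where "g' i j = b ^ i * c ^ j * qpoch (a * q * c) q i * qpoch (b * d) q j" for i j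
  define Y where "Y = (\<Sum>i\<le>m. gauss_binom q (int m) (int i) * g i (m - i))"
  define Y' where "Y' = (\<Sum>i\<le>m. gauss_binom q (int m) (int i) * g' i (m - i))"
  define Y1 where "Y1 = (\<Sum>i\<le>Suc m. gauss_binom q (int (Suc m)) (int i) * g i (Suc m - i))"
  have nz: "qpoch ?E q j \<noteq> 0" for j using E by (auto simp: qpoch_def)
  have E1: "1 - ?E \<noteq> 0" using E[of 0] by simp
  have Em: "1 - ?E * q ^ m \<noteq> 0" using E[of m] by simp
  have Eq: "qpoch ?E q m * (1 - ?E * q ^ m) = (1 - ?E) * qpoch (a * q * b * c * d) q m"
    using qpoch_Suc[of ?E q m] qpoch_Suc_left[of ?E q m] by (simp add: mult_ac)
  have key: "(1 - ?E * q ^ m) * Y - a * Y1 = (1 - a * b) * (1 - a * c) * Y'"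
  proof -
    have "(1 - ?E * q ^ m) * (gauss_binom q (int m) (int i) * g i (m - i))
        - a * (gauss_binom q (int m) (int i) * (g (Suc i) (m - i) + q ^ i * g i (Suc (m - i))))
      = (1 - a * b) * (1 - a * c) * (gauss_binom q (int m) (int i) * g' i (m - i))" if "i \<le> m" for i
    proof -
      define j where "j = m - i"
      have m: "q ^ m = q ^ i * q ^ j" using that by (simp add: j_def flip: power_add)
      have "(1 - a * c) * qpoch (a * q * c) q i = qpoch (a * c) q i * (1 - a * c * q ^ i)"
        using qpoch_Suc[of "a * c" q i] qpoch_Suc_left[of "a * c" q i] by (simp add: mult_ac)
      moreover have "(1 - a * c) * g' i j
          = b ^ i * c ^ j * qpoch (b * d) q j * ((1 - a * c) * qpoch (a * q * c) q i)"
        by (simp add: g'_def mult_ac)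
      ultimately have g': "(1 - a * c) * g' i j = g i j * (1 - a * c * q ^ i)"
        by (simp add: g_def mult_ac)
      have gs: "g (Suc i) j = b * (1 - a * c * q ^ i) * g i j"
          "g i (Suc j) = c * (1 - b * d * q ^ j) * g i j"
        unfolding g_def by (simp_all add: qpoch_Suc mult_ac)
      have "(1 - ?E * q ^ m) * (gauss_binom q (int m) (int i) * g i j)
        - a * (gauss_binom q (int m) (int i) * (g (Suc i) j + q ^ i * g i (Suc j)))
         = (1 - a * b) * (gauss_binom q (int m) (int i) * (g i j * (1 - a * c * q ^ i)))"
        unfolding gs m by algebra
      also have "\<dots> = (1 - a * b) * (1 - a * c) * (gauss_binom q (int m) (int i) * g' i j)"
        unfolding g'[symmetric] by algebra
      finally show ?thesis unfolding j_def .
    qed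
    then show ?thesis
      unfolding Y_def Y1_def Y'_def sum_gauss_binom_Suc sum_distrib_left sum_subtractf[symmetric]
      by (intro sum.cong) auto
  qed
  have X: "pair_seq a b c d q m = Y / qpoch ?E q m"
      "pair_seq a b c d q (Suc m) = Y1 / (qpoch ?E q m * (1 - ?E * q ^ m))"
    "pair_seq (a * q) b c d q m = Y' / qpoch (a * q * b * c * d) q m"
    by (simp_all add: pair_seq_def Y_def Y1_def Y'_def g_def g'_def qpoch_Suc)
  have "pair_seq a b c d q m - a * pair_seq a b c d q (Suc m)
     = ((1 - ?E * q ^ m) * Y - a * Y1) / (qpoch ?E q m * (1 - ?E * q ^ m))"
    unfolding X using nz[of m] Em by (simp add: diff_divide_distrib)
  also have "\<dots> = (1 - a * b) * (1 - a * c) / (1 - ?E) * pair_seq (a * q) b c d q m"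
    unfolding key Eq X by simp
  finally show ?thesis .
qed

end

definition cheb_moment :: "'a::field \<Rightarrow> 'a \<Rightarrow> 'a \<Rightarrow> 'a \<Rightarrow> 'a \<Rightarrow> nat \<Rightarrow> 'a" where
  "cheb_moment a b c d q k = box_sum k a (pair_seq a b c d q) d (aw3_term q (int k))"

text \<open>
  If \<open>s k\<close> is the value of a functional \<open>L\<close> at \<open>U_k\<close>, then \<open>times_2x s\<close> gives the values at \<open>U_k\<close> of
  \<open>p \<mapsto> L (2 x p)\<close>.
\<close>

definition times_2x :: "(nat \<Rightarrow> 'a::field) \<Rightarrow> nat \<Rightarrow> 'a" where
  "times_2x s k = s (Suc k) + (case k of 0 \<Rightarrow> 0 | Suc j \<Rightarrow> s j)"

lemma cheb_moment_rec:
  fixes q :: "'a::field"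
  assumes q0: "q \<noteq> 0" and q1: "\<And>m::nat. m \<ge> 1 \<Longrightarrow> q ^ m \<noteq> 1"
   and E: "\<And>m::nat. a * b * c * d * q ^ m \<noteq> 1"
  shows "(1 + a\<^sup>2) * cheb_moment a b c d q k - a * times_2x (cheb_moment a b c d q) k
    = (1 - a * b) * (1 - a * c) * (1 - a * d) / (1 - a * b * c * d) * cheb_moment (a * q) b c d q k"
proof -
  define K where "K = k + 3"
  have S: "cheb_moment a' b c d q j = box_sum K a' (pair_seq a' b c d q) d (aw3_term q (int j))" if
      "j \<le> k + 1" for a' j
    unfolding cheb_moment_def by (rule box_sum_mono[symmetric])
        (use that in \<open>auto simp: K_def aw3_term_zero\<close>)
  have J: "times_2x (cheb_moment a b c d q) k = box_sum K a (pair_seq a b c d q) d (aw3_term q (int k + 1))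
      + box_sum K a (pair_seq a b c d q) d (aw3_term q (int k - 1))"
  proof (cases k)
    case 0
    have "box_sum K a (pair_seq a b c d q) d (aw3_term q (int k - 1))
        = box_sum K a (pair_seq a b c d q) d (\<lambda>x y z. 0)"
      by (rule box_sum_cong) (auto simp: aw3_term_zero 0)
    then show ?thesis using S[of "Suc k" a] 0 by (simp add: times_2x_def box_sum_def add.commute)
  next
    case (Suc j)
    then show ?thesis using S[of "Suc k" a] S[of j a] by (simp add: times_2x_def add.commute)
  qed
  have "(1 + a\<^sup>2) * cheb_moment a b c d q k - a * times_2x (cheb_moment a b c d q) k
    = (1 - a * d) * (box_sum K (a * q) (pair_seq a b c d q) d (aw3_term q (int k))
        - a * box_sum K (a * q) (\<lambda>m. pair_seq a b c d q (Suc m)) d (aw3_term q (int k)))"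
    unfolding J S[of k, simplified] by (rule box_sum_rec[OF q0 q1]) (auto simp: K_def)
  also have "box_sum K (a * q) (pair_seq a b c d q) d (aw3_term q (int k))
        - a * box_sum K (a * q) (\<lambda>m. pair_seq a b c d q (Suc m)) d (aw3_term q (int k))
      = (1 - a * b) * (1 - a * c) / (1 - a * b * c * d)
          * box_sum K (a * q) (pair_seq (a * q) b c d q) d (aw3_term q (int k))"
  proof -
    have "(\<lambda>m. pair_seq a b c d q m - a * pair_seq a b c d q (Suc m))
      = (\<lambda>m. (1 - a * b) * (1 - a * c) / (1 - a * b * c * d) * pair_seq (a * q) b c d q m)"
      by (rule ext, rule pair_seq_rec) (use q0 q1 E in auto)
    then show ?thesis unfolding box_sum_diff_seq by (simp only: box_sum_scale_seq)
  qed
  also have "box_sum K (a * q) (pair_seq (a * q) b c d q) d (aw3_term q (int k))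
      = cheb_moment (a * q) b c d q k"
    by (rule S[symmetric]) simp
  finally show ?thesis by simp
qed

lemma cheb_moment_0: "cheb_moment a b c d q 0 = 1"
  by (simp add: cheb_moment_def box_sum_def aw3_term_def aw3_coeff_def pair_seq_def gauss_binom_def
      qfact_def qinvfact_def signed_qpow_def qpoch_def)

section \<open>Functionals given by Chebyshev moments\<close>

lemma times_2x_comb: "times_2x (\<lambda>k. x * s k + y * s' k) = (\<lambda>k. x * times_2x s k + y * times_2x s' k)"
  by (rule ext) (simp add: times_2x_def algebra_simps split: nat.split)

lemma times_2x_funpow_comb:
  "(times_2x ^^ n) (\<lambda>k. x * s k + y * s' k) = (\<lambda>k. x * (times_2x ^^ n) s k + y * (times_2x ^^ n) s' k)"
  by (induction n) (simp_all add: times_2x_comb)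

definition cheb_functional :: "(nat \<Rightarrow> 'a::field) \<Rightarrow> 'a poly \<Rightarrow> 'a" where
  "cheb_functional s p = (\<Sum>i\<le>degree p. coeff p i * ((times_2x ^^ i) s 0 / 2 ^ i))"

lemma cheb_functional_ge: "degree p \<le> N \<Longrightarrow> cheb_functional s p
    = (\<Sum>i\<le>N. coeff p i * ((times_2x ^^ i) s 0 / 2 ^ i))"
  unfolding cheb_functional_def by (intro sum.mono_neutral_left) (auto simp: coeff_eq_0)

lemma cheb_functional_add: "cheb_functional s (p + r) = cheb_functional s p + cheb_functional s r"
  using degree_add_le_max[of p r]
  by (simp add: cheb_functional_ge[of _ "max (degree p) (degree r)"] distrib_right add_divide_distrib
      sum.distrib)

lemma cheb_functional_smult: "cheb_functional s (smult e p) = e * cheb_functional s p"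
  using degree_smult_le[of e p]
  by (simp add: cheb_functional_ge[of _ "degree p"] sum_distrib_left mult.assoc)

lemma cheb_functional_diff: "cheb_functional s (p - r) = cheb_functional s p - cheb_functional s r"
  using cheb_functional_add[of s p "smult (-1) r"] cheb_functional_smult[of s "-1" r] by simp

lemma cheb_functional_comb: "cheb_functional (\<lambda>k. x * s k + y * s' k) p
    = x * cheb_functional s p + y * cheb_functional s' p"
  by (simp add: cheb_functional_def times_2x_funpow_comb sum_distrib_left add_divide_distrib
      sum.distrib[symmetric] algebra_simps)

lemma cheb_functional_pCons_0: "cheb_functional s (pCons 0 p) = cheb_functional (times_2x s) p / 2"
proof -
  have "cheb_functional s (pCons 0 p) = (\<Sum>i\<le>Suc (degree p). coeff (pCons 0 p) i
      * ((times_2x ^^ i) s 0 / 2 ^ i))"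
    by (rule cheb_functional_ge) (rule degree_pCons_le)
  also have "\<dots> = (\<Sum>i\<le>degree p. coeff p i * ((times_2x ^^ i) (times_2x s) 0 / 2 ^ i)) / 2"
    by (subst sum.atMost_Suc_shift) (simp add: sum_divide_distrib funpow_swap1 mult.commute[of 2])
  finally show ?thesis by (simp add: cheb_functional_def)
qed

lemma cheb_functional_1: "cheb_functional s 1 = s 0"
  by (simp add: cheb_functional_def)

lemma cheb_functional_monom: "cheb_functional s (monom 1 n) = (times_2x ^^ n) s 0 / 2 ^ n"
proof -
  have "cheb_functional s (monom 1 n) = (\<Sum>i\<le>n. if i = n then (times_2x ^^ i) s 0 / 2 ^ i else 0)"
    unfolding cheb_functional_ge[OF degree_monom_le[of 1 n]] by (intro sum.cong) auto
  then show ?thesis by simp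
qed

lemma rat_choose_Suc: "rat_choose (Suc n) r = rat_choose n r + rat_choose n (r - 1)"
proof (cases "r \<in> \<int>")
  case True
  then obtain i where i: "r = of_int i" by (elim Ints_cases)
  have "of_int i - (1 :: rat) = of_int (i - 1)" by simp
  then have *: "rat_choose n (r - 1) = (if 1 \<le> i then n choose nat (i - 1) else 0)"
    unfolding rat_choose_def i by (simp only: floor_of_int Ints_of_int of_int_0_le_iff) auto
  consider "i < 0" | "i = 0" | j where "i = int (Suc j)"
    by (metis int_cases not0_implies_Suc of_nat_0 negative_zless_0)
  then show ?thesis unfolding *
    by cases (auto simp: rat_choose_def i nat_add_distrib)
next
  case False
  then have "r - 1 \<notin> \<int>" using Ints_add[of "r - 1" 1] by auto
  with False show ?thesis by (simp add: rat_choose_def)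
qed

lemma rat_choose_0: "rat_choose 0 r = (if r = 0 then 1 else 0)"
  by (auto simp: rat_choose_def elim!: Ints_cases)

lemma rat_choose_symmetric: "rat_choose n (of_nat n - r) = rat_choose n r"
proof (induction n arbitrary: r)
  case (Suc n)
  have "of_nat (Suc n) - r - 1 = of_nat n - r" "of_nat (Suc n) - r = of_nat n - (r - 1)" by simp_all
  then show ?case unfolding rat_choose_Suc by (simp only: Suc.IH)
qed (simp add: rat_choose_0)

definition ballot :: "nat \<Rightarrow> nat \<Rightarrow> 'a::field_char_0" where
  "ballot n k = of_nat (rat_choose n ((of_nat n - of_nat k) / 2))
      - of_nat (rat_choose n ((of_nat n - of_nat k) / 2 - 1))"

lemma ballot_Suc_0: "ballot (Suc n) 0 = ballot n 1"
proof -
  have "rat_choose n ((of_nat n + 1) / 2) = rat_choose n (of_nat n - (of_nat n - 1) / 2)"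
    by (rule arg_cong[where f = "rat_choose n"]) (simp add: field_simps)
  also have "\<dots> = rat_choose n ((of_nat n - 1) / 2)" by (rule rat_choose_symmetric)
  finally have *: "rat_choose n ((of_nat n + 1) / 2) = rat_choose n ((of_nat n - 1) / 2)" .
  have "(of_nat (Suc n) - of_nat 0) / 2 = (of_nat n + 1 :: rat) / 2"
    "(of_nat n + 1) / 2 - 1 = (of_nat n - 1 :: rat) / 2"
    "(of_nat n - of_nat 1) / 2 = (of_nat n - 1 :: rat) / 2" by (simp_all add: field_simps)
  then show ?thesis unfolding ballot_def rat_choose_Suc by (simp only: *) simp
qed

lemma ballot_Suc_Suc: "ballot (Suc n) (Suc k) = ballot n k + ballot n (Suc (Suc k))"
proof -
  have "(of_nat (Suc n) - of_nat (Suc k)) / 2 = (of_nat n - of_nat k :: rat) / 2"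
    "(of_nat n - of_nat (Suc (Suc k))) / 2 = (of_nat n - of_nat k :: rat) / 2 - 1"
        by (simp_all add: field_simps)
  then show ?thesis unfolding ballot_def rat_choose_Suc by (simp only:) simp
qed

lemma ballot_eq_0: "k > n \<Longrightarrow> ballot n k = 0"
  by (simp add: ballot_def rat_choose_def)

lemma times_2x_funpow_0: "(times_2x ^^ n) s 0 = (\<Sum>k\<le>n. ballot n k * s k)"
proof (induction n arbitrary: s)
  case 0
  show ?case by (simp add: ballot_def rat_choose_0)
next
  case (Suc n)
  have "(times_2x ^^ Suc n) s 0 = (\<Sum>k\<le>n. ballot n k * times_2x s k)"
    by (simp only: funpow_Suc_right o_apply Suc.IH)
  also have "\<dots> = (\<Sum>k\<le>n. ballot n k * s (Suc k)) + (\<Sum>k\<le>n. ballot n k * (case k of 0 \<Rightarrow> 0 | Suc j \<Rightarrow> s j))"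
    by (simp add: times_2x_def distrib_left sum.distrib)
  also have "(\<Sum>k\<le>n. ballot n k * (case k of 0 \<Rightarrow> 0 | Suc j \<Rightarrow> s j))
      = (\<Sum>k\<le>Suc (Suc n). ballot n k * (case k of 0 \<Rightarrow> 0 | Suc j \<Rightarrow> s j))"
    by (simp add: ballot_eq_0)
  also have "\<dots> = (\<Sum>k\<le>Suc n. ballot n (Suc k) * s k)"
    by (subst sum.atMost_Suc_shift) simp
  also have "\<dots> = ballot (Suc n) 0 * s 0 + (\<Sum>k\<le>n. ballot n (Suc (Suc k)) * s (Suc k))"
    by (subst sum.atMost_Suc_shift) (simp add: ballot_Suc_0)
  also have "(\<Sum>k\<le>n. ballot n k * s (Suc k)) + \<dots>
      = ballot (Suc n) 0 * s 0 + (\<Sum>k\<le>n. ballot (Suc n) (Suc k) * s (Suc k))"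
    by (simp add: ballot_Suc_Suc sum.distrib distrib_right)
  also have "\<dots> = (\<Sum>k\<le>Suc n. ballot (Suc n) k * s k)"
    by (rule sum.atMost_Suc_shift[symmetric])
  finally show ?case .
qed

section \<open>Values on the Askey-Wilson polynomials\<close>

text \<open>
  The three-term recurrence for the product formula \<open>cheb_functional_aw_poly\<close> below, divided by
  the factors common to all its terms.  Here \<open>P = q^n\<close>, \<open>M = q^m\<close>, and \<open>e1, e2, e3\<close> are the elementary
  symmetric polynomials in \<open>b, c, d\<close>.
\<close>

lemma aw_recurrence_identity:
  fixes a e1 e2 e3 E q P M :: "'a::field_char_0"
  assumes "E = a * e3" "a \<noteq> 0" "M \<noteq> 0"
    "1 - E*M*P \<noteq> 0" "1 - E*M*(q*P) \<noteq> 0" "1 - E*P*P \<noteq> 0" "1 - E*P*(q*P) \<noteq> 0" "1 - E*(q*P)*(q*P) \<noteq> 0"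
  shows "a*(M-P)*(1 - q*P*e2+(q*P)^2*e3*e1-(q*P)^3*e3^2)*(1-E*P)*(M-q*P)/((1 - E*M*P)*(1
      - E*M*(q*P))*(1 - E*P*(q*P))*(1 - E*(q*P)*(q*P)))
   = ((1+a^2*M^2)*((M-P)/(1-E*M*P)) - (1
       - a*M*e1+a^2*M^2*e2-a^3*M^3*e3)*P*(q*M-1)/((1 - E*M*P)*(1 - E*M*(q*P))))/(a*M)
    - (a+1/a - (1-E*P)/((1 - E*P*(q*P))*(1 - E*(q*P)*(q*P)))*(1
        - a*(q*P)*e1+a^2*(q*P)^2*e2-a^3*(q*P)^3*e3)/a
          - a*(1-q*P)*(1 - P*e2+P^2*e3*e1-P^3*e3^2)/((1-E*P*P)*(1-E*P*(q*P))))*((M-P)/(1-E*M*P))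
    - (1 - a*P*e1+a^2*P^2*e2-a^3*P^3*e3)*(1-q*P)/(a*(1-E*P*P)*(1-E*P*(q*P)))"
proof -
  define u1 u2 u3 u4 u5 where u: "u1 = 1 - E*M*P" "u2 = 1 - E*M*(q*P)" "u3 = 1 - E*P*P"
      "u4 = 1 - E*P*(q*P)" "u5 = 1 - E*(q*P)*(q*P)"
  have nz: "u1\<noteq>0" "u2\<noteq>0" "u3\<noteq>0" "u4\<noteq>0" "u5\<noteq>0" using assms u by auto
  have pol: "a*a*M*(M-P)*(1 - q*P*e2+(q*P)^2*e3*e1-(q*P)^3*e3^2)*(1-E*P)*(M-q*P)*u3
   = (((1+a^2*M^2)*(M-P)*u2 - (1 - a*M*e1+a^2*M^2*e2-a^3*M^3*e3)*P*(q*M-1))*u3*u4*u5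
    - M*((a*a+1)*u3*u4*u5 - (1-E*P)*(1 - a*(q*P)*e1+a^2*(q*P)^2*e2-a^3*(q*P)^3*e3)*u3
          - a*a*(1-q*P)*(1 - P*e2+P^2*e3*e1-P^3*e3^2)*u5)*(M-P)*u2
    - M*(1 - a*P*e1+a^2*P^2*e2-a^3*P^3*e3)*(1-q*P)*u1*u2*u5)"
    unfolding u assms(1) by algebra
  show ?thesis
    unfolding u[symmetric] using nz assms(2,3) pol by (simp add: divide_simps) algebra
qed

text \<open>
  Keeping the factor \<open>1 - E q^(n-1)\<close> of \<open>aw_A\<close> inside \<open>aw_factor\<close> makes the recurrence
  uniform in \<open>n\<close>, in spite of the cancellation at \<open>n = 0\<close>.
\<close>

definition aw_factor :: "'a::field \<Rightarrow> 'a \<Rightarrow> nat \<Rightarrow> 'a" where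
  "aw_factor E q n = (if n = 0 then 1 / (1 - E)
      else (1 - E * q ^ (n - 1)) / ((1 - E * q ^ (2 * n - 1)) * (1 - E * q ^ (2 * n))))"

definition triple_factor :: "'a::field \<Rightarrow> 'a \<Rightarrow> 'a \<Rightarrow> 'a \<Rightarrow> 'a" where
  "triple_factor x y z Q = (1 - x * Q) * (1 - y * Q) * (1 - z * Q)"

definition norm_const :: "'a::field \<Rightarrow> 'a \<Rightarrow> 'a \<Rightarrow> 'a \<Rightarrow> 'a \<Rightarrow> nat \<Rightarrow> 'a" where
  "norm_const a b c d q n = (\<Prod>i<n. a / 2 * triple_factor (b * c) (b * d) (c * d) (q ^ i)
      * aw_factor (a * b * c * d) q i)"

definition node_prod :: "'a::field \<Rightarrow> 'a \<Rightarrow> nat \<Rightarrow> nat \<Rightarrow> 'a" where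
  "node_prod E q n m = (\<Prod>i<n. (q ^ m - q ^ i) / (1 - E * q ^ (m + i)))"

lemma aw_factor_Suc: "aw_factor E q (Suc n)
    = (1 - E * q ^ n) / ((1 - E * q ^ n * (q * q ^ n)) * (1 - E * (q * q ^ n) * (q * q ^ n)))"
proof -
  have "q ^ (2 * Suc n - 1) = q ^ n * (q * q ^ n)" "q ^ (2 * Suc n) = q * q ^ n * (q * q ^ n)"
    by (simp_all add: mult_2 power_add)
  then show ?thesis unfolding aw_factor_def by (simp only: diff_Suc_1 nat.simps if_False mult.assoc)
qed

lemma aw_A_aw_factor: "aw_A a b c d q n = aw_factor (a * b * c * d) q n
    * triple_factor (a * b) (a * c) (a * d) (q ^ n) / a"
  by (auto simp: aw_A_def aw_factor_def triple_factor_def mult_ac)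

lemma aw_C_Suc: "aw_C a b c d q (Suc n) = a * (1 - q * q ^ n)
    * triple_factor (b * c) (b * d) (c * d) (q ^ n)
    / ((1 - a * b * c * d * q ^ n * q ^ n) * (1 - a * b * c * d * q ^ n * (q * q ^ n)))"
proof -
  have "q ^ (2 * Suc n - 1) = q ^ n * (q * q ^ n)" "q ^ (2 * Suc n - 2) = q ^ n * q ^ n"
    by (simp_all add: mult_2 power_add)
  then show ?thesis by (simp add: aw_C_def triple_factor_def mult.assoc)
qed

lemma node_prod_Suc: "node_prod E q (Suc n) m
    = node_prod E q n m * ((q ^ m - q ^ n) / (1 - E * q ^ m * q ^ n))"
  by (simp add: node_prod_def power_add mult.assoc)

lemma node_prod_Suc_Suc:
  assumes "\<And>j::nat. E * q ^ j \<noteq> 1"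
  shows "node_prod E q (Suc n) (Suc m) = node_prod E q n m *
    (q ^ n * (q * q ^ m - 1) * (1 - E * q ^ m) / ((1 - E * q ^ m * q ^ n) * (1 - E * q ^ m * (q * q ^ n))))"
proof (induction n)
  case 0
  then show ?case using assms[of m] by (simp add: node_prod_def mult_ac)
next
  case (Suc n)
  define P where "P = q ^ n"
  define M where "M = q ^ m"
  have nz: "1 - E * M * P \<noteq> 0" "1 - E * M * (q * P) \<noteq> 0" "1 - E * M * (q * (q * P)) \<noteq> 0"
    using assms[of "m + n"] assms[of "m + Suc n"] assms[of "m + Suc (Suc n)"]
    by (simp_all add: P_def M_def power_add mult_ac)
  show ?case
    unfolding node_prod_Suc[of E q "Suc n" "Suc m"] Suc.IH
        unfolding node_prod_Suc power_Suc P_def[symmetric] M_def[symmetric]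
    using nz by (simp add: divide_simps) (simp add: algebra_simps)
qed

lemma cheb_functional_Jop:
  fixes q :: "'a::field"
  assumes "a \<noteq> 0" and q0: "q \<noteq> 0" and q1: "\<And>m::nat. m \<ge> 1 \<Longrightarrow> q ^ m \<noteq> 1"
    and E: "\<And>m::nat. a * b * c * d * q ^ m \<noteq> 1"
  shows "cheb_functional (times_2x (cheb_moment a b c d q)) p
      = ((1 + a\<^sup>2) * cheb_functional (cheb_moment a b c d q) p
      - (1 - a * b) * (1 - a * c) * (1 - a * d) / (1 - a * b * c * d)
          * cheb_functional (cheb_moment (a * q) b c d q) p) / a"
proof -
  let ?k = "(1 - a * b) * (1 - a * c) * (1 - a * d) / (1 - a * b * c * d)"
  have *: "(\<lambda>k. (1 + a\<^sup>2) * cheb_moment a b c d q k + (- a) * times_2x (cheb_moment a b c d q) k)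
     = (\<lambda>k. ?k * cheb_moment (a * q) b c d q k + 0 * cheb_moment (a * q) b c d q k)"
    by (rule ext) (use cheb_moment_rec[OF q0 q1 E] in simp)
  have "(1 + a\<^sup>2) * cheb_functional (cheb_moment a b c d q) p
      + (- a) * cheb_functional (times_2x (cheb_moment a b c d q)) p
      = ?k * cheb_functional (cheb_moment (a * q) b c d q) p
          + 0 * cheb_functional (cheb_moment (a * q) b c d q) p"
    unfolding cheb_functional_comb[symmetric] * ..
  then have "a * cheb_functional (times_2x (cheb_moment a b c d q)) p
      = (1 + a\<^sup>2) * cheb_functional (cheb_moment a b c d q) p
      - ?k * cheb_functional (cheb_moment (a * q) b c d q) p"
    by algebra
  then show ?thesis using assms(1) by (metis nonzero_mult_div_cancel_left)
qed

lemma triple_factor_expand: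
  "triple_factor (a * b) (a * c) (a * d) X
      = 1 - a * X * (b+c+d) + a^2 * X^2 * (b*c+b*d+c*d) - a^3 * X^3 * (b*c*d)"
  "triple_factor (b * c) (b * d) (c * d) X
      = 1 - X * (b*c+b*d+c*d) + X^2 * (b*c*d) * (b+c+d) - X^3 * (b*c*d)^2"
  for a :: "'a::field"
  unfolding triple_factor_def by algebra+

lemma cheb_functional_aw_poly:
  fixes q :: "'a::field_char_0"
  assumes a: "a \<noteq> 0" and q0: "q \<noteq> 0" and q1: "\<And>m::nat. m \<ge> 1 \<Longrightarrow> q ^ m \<noteq> 1"
    and E: "\<And>m::nat. a * b * c * d * q ^ m \<noteq> 1"
  shows "cheb_functional (cheb_moment (a * q ^ m) b c d q) (aw_poly a b c d q n)
      = norm_const a b c d q n * node_prod (a * b * c * d) q n m"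
proof -
  let ?E = "a * b * c * d"
  define E' where "E' = a * b * c * d"
  have E': "E' * q ^ j \<noteq> 1" for j using E by (simp add: E'_def)
  define kap where "kap m = triple_factor (a * b) (a * c) (a * d) (q ^ m) / (1 - E' * q ^ m)" for m
  define s where "s m = cheb_moment (a * q ^ m) b c d q" for m
  have J: "cheb_functional (times_2x (s m)) p
      = ((1 + a^2 * (q ^ m)^2) * cheb_functional (s m) p - kap m * cheb_functional (s (Suc m)) p)
      / (a * q ^ m)" for m p
  proof -
    have "a * q ^ m * b * c * d * q ^ j \<noteq> 1" for j
      using E[of "m + j"] by (simp add: power_add mult_ac)
    from cheb_functional_Jop[OF _ q0 q1 this, of p] a q0 show ?thesis
      by (simp add: s_def kap_def E'_def triple_factor_def mult_ac power_mult_distrib)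
  qed
  have step: "cheb_functional (s m) ([:- e, 1:] * p) = - e * cheb_functional (s m) p
     + ((1 + a^2 * (q ^ m)^2) * cheb_functional (s m) p - kap m * cheb_functional (s (Suc m)) p)
         / (a * q ^ m) / 2" for e m p
    by (simp add: mult_pCons_left cheb_functional_add cheb_functional_smult cheb_functional_pCons_0 J
        cheb_functional_diff)
  have R0: "cheb_functional (s m) (aw_poly a b c d q 0) = norm_const a b c d q 0 * node_prod E' q 0 m" for m
    by (simp add: cheb_functional_1 s_def cheb_moment_0 norm_const_def node_prod_def)
  have R1: "cheb_functional (s m) (aw_poly a b c d q 1) = norm_const a b c d q 1 * node_prod E' q 1 m" for m
  proof -
    define M where "M = q ^ m"
    have M: "M \<noteq> 0" using q0 by (simp add: M_def)
    have nz: "1 - E' \<noteq> 0" "1 - E' * M \<noteq> 0" using E'[of 0] E'[of m] by (simp_all add: M_def)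
    have l: "cheb_functional (s m) 1 = 1" for m by (simp add: cheb_functional_1 s_def cheb_moment_0)
    have "cheb_functional (s m) (aw_poly a b c d q 1)
        = - aw_b a b c d q 0 + ((1 + a^2 * M^2) - kap m) / (a * M) / 2"
      using step[of m "aw_b a b c d q 0" 1] by (simp add: l M_def)
    also have "kap m = triple_factor (a * b) (a * c) (a * d) M / (1 - E' * M)" by (simp add: kap_def M_def)
    also have "aw_b a b c d q 0 = (a + 1 / a - triple_factor (a * b) (a * c) (a * d) 1 / (1 - E') / a) / 2"
      by (simp add: aw_b_def aw_A_aw_factor aw_factor_def aw_C_def E'_def inverse_eq_divide)
    also have "- ((a + 1 / a - triple_factor (a * b) (a * c) (a * d) 1 / (1 - E') / a) / 2)
         + ((1 + a^2 * M^2) - triple_factor (a * b) (a * c) (a * d) M / (1 - E' * M)) / (a * M) / 2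
      = a / 2 * triple_factor (b * c) (b * d) (c * d) 1 / (1 - E') * ((M - 1) / (1 - E' * M))"
      using nz a M unfolding triple_factor_def by (simp add: divide_simps) (simp add: E'_def, algebra)
    also have "\<dots> = norm_const a b c d q 1 * node_prod E' q 1 m"
      by (simp add: norm_const_def node_prod_def aw_factor_def E'_def M_def)
    finally show ?thesis .
  qed
  have R2: "cheb_functional (s m) (aw_poly a b c d q (Suc (Suc n)))
      = norm_const a b c d q (Suc (Suc n)) * node_prod E' q (Suc (Suc n)) m"
    if IH0: "\<And>m. cheb_functional (s m) (aw_poly a b c d q n) = norm_const a b c d q n * node_prod E' q n m"
    and IH1: "\<And>m. cheb_functional (s m) (aw_poly a b c d q (Suc n))
        = norm_const a b c d q (Suc n) * node_prod E' q (Suc n) m" for n m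
  proof -
    define P where "P = q ^ n"
    define M where "M = q ^ m"
    let ?S = "triple_factor (a * b) (a * c) (a * d)" and ?T = "triple_factor (b * c) (b * d) (c * d)"
    define G where "G = norm_const a b c d q n * node_prod E' q n m * (a / 2 * ?T P * aw_factor E' q n)"
    have M: "M \<noteq> 0" using q0 by (simp add: M_def)
    have nz: "1 - E' * M * P \<noteq> 0" "1 - E' * M * (q * P) \<noteq> 0" "1 - E' * P * P \<noteq> 0"
      "1 - E' * P * (q * P) \<noteq> 0" "1 - E' * (q * P) * (q * P) \<noteq> 0"
      using E'[of "m + n"] E'[of "m + Suc n"] E'[of "n + n"] E'[of "n + Suc n"] E'[of "Suc n + Suc n"]
      by (simp_all add: P_def M_def power_add mult_ac)
    have nzM: "1 - E' * M \<noteq> 0" using E'[of m] by (simp add: M_def)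
    have rho1: "norm_const a b c d q (Suc n) = norm_const a b c d q n * (a / 2 * ?T P * aw_factor E' q n)"
      by (simp add: norm_const_def P_def E'_def)
    have rho2: "norm_const a b c d q (Suc (Suc n)) = norm_const a b c d q (Suc n)
        * (a / 2 * ?T (q * P) * ((1 - E' * P) / ((1 - E' * P * (q * P)) * (1 - E' * (q * P) * (q * P)))))"
      by (simp add: norm_const_def aw_factor_Suc flip: P_def E'_def)
    define x where "x = (M - P) / (1 - E' * M * P)"
    define y where "y = P * (q * M - 1) / ((1 - E' * M * P) * (1 - E' * M * (q * P)))"
    define z where "z = (1 - q * P) / (a * (1 - E' * P * P) * (1 - E' * P * (q * P)))"
    define B where "B = a + 1 / a - (1 - E' * P)
        / ((1 - E' * P * (q * P)) * (1 - E' * (q * P) * (q * P))) * ?S (q * P) / a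
        - a * (1 - q * P) * ?T P / ((1 - E' * P * P) * (1 - E' * P * (q * P)))"
    have L0: "aw_lambda a b c d q (Suc n) * cheb_functional (s m) (aw_poly a b c d q n)
        = G * (?S P * z) / 2"
      unfolding IH0 aw_lambda_def diff_Suc_1 aw_A_aw_factor aw_C_Suc P_def[symmetric] E'_def[symmetric]
      using a by (simp add: G_def z_def mult_ac)
    have L1: "cheb_functional (s m) (aw_poly a b c d q (Suc n)) = G * x"
      unfolding IH1 rho1 node_prod_Suc by (simp add: G_def x_def P_def M_def)
    have L2: "kap m * cheb_functional (s (Suc m)) (aw_poly a b c d q (Suc n)) = G * (?S M * y)"
      unfolding IH1 rho1 node_prod_Suc_Suc[OF E'] kap_def
      using nzM by (simp add: G_def y_def flip: P_def M_def)
    have b: "aw_b a b c d q (Suc n) = B / 2"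
      by (simp add: aw_b_def aw_A_aw_factor aw_C_Suc aw_factor_Suc B_def inverse_eq_divide flip: P_def
          E'_def)
    have "cheb_functional (s m) (aw_poly a b c d q (Suc (Suc n)))
      = - (B / 2) * (G * x) + ((1 + a^2 * M^2) * (G * x) - G * (?S M * y)) / (a * M) / 2
          - G * (?S P * z) / 2"
      unfolding aw_poly.simps cheb_functional_diff cheb_functional_smult step L0 L1 L2 b M_def ..
    also have "\<dots> = G / 2 * (((1 + a^2 * M^2) * x - ?S M * y) / (a * M) - B * x - ?S P * z)"
      using a M by (simp add: field_simps)
    also have "((1 + a^2 * M^2) * x - ?S M * y) / (a * M) - B * x - ?S P * z
      = a*(M-P)*?T (q*P)*(1-E'*P)*(M-q*P)/((1 - E'*M*P)*(1 - E'*M*(q*P))*(1 - E'*P*(q*P))*(1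
          - E'*(q*P)*(q*P)))"
    proof -
      have "E' = a * (b * c * d)" by (simp add: E'_def mult_ac)
      from aw_recurrence_identity[OF this a M nz, where ?e1.0 = "b + c + d" and ?e2.0 = "b*c+b*d+c*d"]
          show ?thesis
        unfolding x_def y_def z_def B_def triple_factor_expand by (simp add: mult_ac)
    qed
    also have "G / 2 * \<dots> = norm_const a b c d q (Suc (Suc n)) * node_prod E' q (Suc (Suc n)) m"
      unfolding rho2 rho1 node_prod_Suc power_Suc P_def[symmetric] M_def[symmetric] G_def
          by (simp add: mult_ac)
    finally show ?thesis .
  qed
  have "cheb_functional (s m) (aw_poly a b c d q n) = norm_const a b c d q n * node_prod E' q n m"
    by (induction n arbitrary: m rule: induct_nat_012) (use R0 R1 R2 in simp_all)
  then show ?thesis by (simp only: s_def E'_def)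
qed

lemma aw_moment_eq:
  fixes q :: "'a::field_char_0"
  assumes "a \<noteq> 0" and "q \<noteq> 0" and "\<And>m::nat. m \<ge> 1 \<Longrightarrow> q ^ m \<noteq> 1"
    and "\<And>m::nat. a * b * c * d * q ^ m \<noteq> 1"
  shows "2 ^ n * aw_moment n a b c d q = (\<Sum>k\<le>n. ballot n k * cheb_moment a b c d q k)"
proof -
  let ?L = "cheb_functional (cheb_moment a b c d q)"
  have "?L (aw_poly a b c d q n) = 0" if "n \<ge> 1" for n
  proof -
    have "node_prod (a * b * c * d) q n 0 = 0" unfolding node_prod_def
      by (rule prod_zero, simp, rule bexI[of _ 0]) (use that in auto)
    then show ?thesis using cheb_functional_aw_poly[OF assms, of 0 n] by simp
  qed
  moreover have "Vector_Spaces.linear smult (*) ?L"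
    by (auto simp: Vector_Spaces.linear_iff vector_space_def smult_add_right smult_add_left
        algebra_simps cheb_functional_add cheb_functional_smult)
  ultimately have "is_aw_functional a b c d q ?L"
    by (simp add: is_aw_functional_def cheb_functional_1 cheb_moment_0)
  then have "aw_functional a b c d q = ?L"
    unfolding aw_functional_def by (rule the1_equality[OF ex1_aw_functional])
  then show ?thesis by (simp add: aw_moment_def cheb_functional_monom times_2x_funpow_0)
qed

lemma cheb_moment_eq:
  fixes q :: "'a::field"
  assumes q0: "q \<noteq> 0" and q1: "\<And>m::nat. m \<ge> 1 \<Longrightarrow> q ^ m \<noteq> 1"
  shows "cheb_moment a b c d q k =
    (\<Sum>(\<alpha>, \<beta>, \<gamma>, \<delta>, t)\<in>aw_index k.
          a ^ \<alpha> * b ^ \<beta> * c ^ \<gamma> * d ^ \<delta>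
          * (qpoch (a * c) q \<beta> * qpoch (b * d) q \<gamma> / qpoch (a * b * c * d) q (\<beta> + \<gamma>))
          * (-1) powi t * q powi (t * (t + 1) div 2)
          * qbinom q (int \<alpha> + int \<beta> + int \<gamma> + t) (int \<alpha>)
          * qtrinom q (int \<beta>) (int \<gamma>) (int \<delta> + t)
          * qbinom q (int \<delta> + int \<alpha> + t) (int \<delta>))"
    (is "_ = sum ?f _")
proof -
  define g where "g x y z i = a ^ x * (gauss_binom q (int y) (int i)
      * (b ^ i * c ^ (y - i) * qpoch (a * c) q i * qpoch (b * d) q (y - i)))
      / qpoch (a * b * c * d) q y * d ^ z * aw3_term q (int k) (int x) (int y) (int z)" for x y z i
  define B where "B = (SIGMA x:{..k}. SIGMA y:{..k}. SIGMA z:{..k}. {..y})"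
  have f: "?f (\<alpha>, \<beta>, \<gamma>, \<delta>, t) = g \<alpha> (\<beta> + \<gamma>) \<delta> \<beta>" if "(\<alpha>, \<beta>, \<gamma>, \<delta>, t) \<in> aw_index k" for \<alpha> \<beta> \<gamma> \<delta> t
  proof -
    have W: "aw3_term q (int k) (int \<alpha>) (int (\<beta> + \<gamma>)) (int \<delta>) = aw3_coeff q (int \<alpha>) (int (\<beta> + \<gamma>)) (int \<delta>) t"
      by (rule aw3_term_eq) (use that in \<open>auto simp: aw_index_def\<close>)
    have qb: "qbinom q (x + y) x = qfact q (x + y) * qinvfact q x * qinvfact q y" for x y
      by (auto simp: qbinom_def qfact_def qinvfact_def divide_simps)
    have qt: "qtrinom q x y z = qfact q (x + y + z) * qinvfact q x * qinvfact q y * qinvfact q z" for x y z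
      by (auto simp: qtrinom_def qfact_def qinvfact_def divide_simps)
    have 1: "qfact q (int \<beta> + int \<gamma>) * qinvfact q (int \<beta> + int \<gamma>) = 1"
      using qpoch_qq_nz[OF q0 q1, of "nat (int \<beta> + int \<gamma>)"] by (simp add: qfact_def qinvfact_def)
    have e: "int \<alpha> + int \<beta> + int \<gamma> + t = int \<alpha> + (int \<beta> + int \<gamma> + t)"
        "int \<delta> + int \<alpha> + t = int \<delta> + (int \<alpha> + t)"
      by simp_all
    have W': "aw3_coeff q (int \<alpha>) (int (\<beta> + \<gamma>)) (int \<delta>) t = (-1) powi t * q powi (t * (t + 1) div 2)
        * qfact q (int \<alpha> + (int \<beta> + int \<gamma> + t)) * qfact q (int \<beta> + int \<gamma> + (int \<delta> + t))
            * qfact q (int \<delta> + (int \<alpha> + t))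
        * qinvfact q (int \<alpha>) * qinvfact q (int \<beta> + int \<gamma>) * qinvfact q (int \<delta>)
        * qinvfact q (int \<alpha> + t) * qinvfact q (int \<beta> + int \<gamma> + t) * qinvfact q (int \<delta> + t)"
      by (simp add: aw3_coeff_def signed_qpow_def add.assoc)
    have "g \<alpha> (\<beta> + \<gamma>) \<delta> \<beta> = (qfact q (int \<beta> + int \<gamma>) * qinvfact q (int \<beta> + int \<gamma>)) * ?f (\<alpha>, \<beta>, \<gamma>, \<delta>, t)"
      unfolding g_def W W' case_prod_conv e qb qt gauss_binom_def
          by (simp only: of_nat_add add_diff_cancel_left' times_divide_eq_left times_divide_eq_right
          mult_ac)
    then show ?thesis unfolding 1 by simp
  qed
  have "cheb_moment a b c d q k = (\<Sum>(x, y, z, i)\<in>B. g x y z i)"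
    unfolding B_def cheb_moment_def box_sum_def pair_seq_def g_def
    by (simp add: sum.Sigma[symmetric] sum_distrib_left sum_distrib_right sum_divide_distrib mult_ac)
  also have "\<dots> = sum ?f (aw_index k)"
  proof (rule sum.reindex_bij_witness_not_neutral[symmetric])
    let ?S' = "{u \<in> aw_index k. ?f u = 0}" and ?T' = "{(x, y, z, i) \<in> B. g x y z i = 0}"
    let ?j = "\<lambda>(\<alpha>, \<beta>, \<gamma>, \<delta>, t :: int). (\<alpha>, \<beta> + \<gamma> :: nat, \<delta> :: nat, \<beta>)"
    let ?i = "\<lambda>(x, y, z, i). (x, i, y - i, z, (int k - int x - int y - int z) div 2)"
    show "finite ?S'" using finite_aw_index by simp
    have "finite B" unfolding B_def by simp
    then show "finite ?T'" by (rule rev_finite_subset) auto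
    show "?i (?j u) = u" if "u \<in> aw_index k - ?S'" for u
      using that by (auto simp: aw_index_def)
    show "?j u \<in> B - ?T'" if u: "u \<in> aw_index k - ?S'" for u
    proof -
      obtain \<alpha> \<beta> \<gamma> \<delta> t where [simp]: "u = (\<alpha>, \<beta>, \<gamma>, \<delta>, t)" by (cases u)
      have "?f u = g \<alpha> (\<beta> + \<gamma>) \<delta> \<beta>" unfolding \<open>u = _\<close> by (rule f) (use u in simp)
      moreover have "?f u \<noteq> 0" using u by blast
      ultimately have nz: "g \<alpha> (\<beta> + \<gamma>) \<delta> \<beta> \<noteq> 0" by metis
      then have "aw3_term q (int k) (int \<alpha>) (int (\<beta> + \<gamma>)) (int \<delta>) \<noteq> 0" by (auto simp: g_def)
      then have "\<alpha> \<le> k" "\<beta> + \<gamma> \<le> k" "\<delta> \<le> k"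
        using aw3_term_zero[of "int \<alpha>" "int (\<beta> + \<gamma>)" "int \<delta>" "int k" q] by linarith+
      with nz show ?thesis by (simp add: B_def)
    qed
    have inv: "?i v \<in> aw_index k" "?j (?i v) = v" if v: "v \<in> B - ?T'" for v
    proof -
      obtain x y z i where [simp]: "v = (x, y, z, i)" by (cases v)
      have le: "x \<le> k" "y \<le> k" "z \<le> k" "i \<le> y" and "g x y z i \<noteq> 0"
        using v by (auto simp: B_def)
      then have W: "aw3_term q (int k) (int x) (int y) (int z) \<noteq> 0" by (auto simp: g_def)
      then have "even (int k - int x - int y - int z)" using aw3_term_odd by blast
      then obtain t where t: "int k - int x - int y - int z = 2 * t" by (rule evenE)
      have "int x + t \<ge> 0"
        using W aw3_coeff_zero[of "int x" "int y" "int z" t q] unfolding aw3_term_eq[OF t] by linarith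
      then show "?i v \<in> aw_index k" "?j (?i v) = v" using le t by (auto simp: aw_index_def)
    qed
    show "?j (?i v) = v" if "v \<in> B - ?T'" for v by (rule inv[OF that])
    show "?i v \<in> aw_index k - ?S'" if v: "v \<in> B - ?T'" for v
    proof -
      obtain x y z i where [simp]: "v = (x, y, z, i)" by (cases v)
      show ?thesis using v inv[OF v] f[of x i "y - i" z "(int k - int x - int y - int z) div 2"] by simp
    qed
    show "?f u = 0" if "u \<in> ?S'" for u using that by simp
    show "(case v of (x, y, z, i) \<Rightarrow> g x y z i) = 0" if "v \<in> ?T'" for v using that by auto
    show "(case ?j u of (x, y, z, i) \<Rightarrow> g x y z i) = ?f u" if u: "u \<in> aw_index k" for u
    proof -
      obtain \<alpha> \<beta> \<gamma> \<delta> t where [simp]: "u = (\<alpha>, \<beta>, \<gamma>, \<delta>, t)" by (cases u)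
      show ?thesis using f[of \<alpha> \<beta> \<gamma> \<delta> t] u by simp
    qed
  qed
  finally show ?thesis .
qed

theorem theorem5p8:
  fixes a b c d q :: "'a::field_char_0" and n :: nat
  assumes "a \<noteq> 0" and "q \<noteq> 0"
    and "\<And>m::nat. m \<ge> 1 \<Longrightarrow> q ^ m \<noteq> 1"
    and "\<And>m::nat. a * b * c * d * q ^ m \<noteq> 1"
  shows "2 ^ n * aw_moment n a b c d q =
    (\<Sum>k=0..n.
      (of_nat (rat_choose n ((of_nat n - of_nat k) / 2))
        - of_nat (rat_choose n ((of_nat n - of_nat k) / 2 - 1)))
      * (\<Sum>(\<alpha>, \<beta>, \<gamma>, \<delta>, t)\<in>aw_index k.
          a ^ \<alpha> * b ^ \<beta> * c ^ \<gamma> * d ^ \<delta>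
          * (qpoch (a * c) q \<beta> * qpoch (b * d) q \<gamma> / qpoch (a * b * c * d) q (\<beta> + \<gamma>))
          * (-1) powi t * q powi (t * (t + 1) div 2)
          * qbinom q (int \<alpha> + int \<beta> + int \<gamma> + t) (int \<alpha>)
          * qtrinom q (int \<beta>) (int \<gamma>) (int \<delta> + t)
          * qbinom q (int \<delta> + int \<alpha> + t) (int \<delta>)))"
proof -
  have "2 ^ n * aw_moment n a b c d q = (\<Sum>k\<le>n. ballot n k * cheb_moment a b c d q k)"
    by (rule aw_moment_eq) (use assms in auto)
  then show ?thesis
    unfolding ballot_def atMost_atLeast0
    by (rule trans) (intro sum.cong refl arg_cong2[where f = "(*)"] cheb_moment_eq assms; assumption)
qed

end
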